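(* Let $\Delta$ be a pure simplicial tree and let $k\ge 1$ be an integer. If $I(\Delta)^{[k]}$ is linearly related, then $I(\Delta)^{[k+1]}$ is also linearly related.
   Context: A simplicial complex $\Delta$ on a finite vertex set is a non-empty collection of subsets (faces) closed under taking subsets; its facets are the inclusion-maximal faces, and $\mathcal F(\Delta)$ is the set of facets. $\Delta$ is pure if all facets have the same cardinality. A subcollection of $\Delta$ is a simplicial complex $\Delta'$ with $\mathcal F(\Delta')\subseteq\mathcal F(\Delta)$. A facet $F$ of $\Delta$ is a leaf if either $F$ is the only facet of $\Delta$ or there is a facet $G\neq F$ of $\Delta$ with $H\cap F\subseteq G\cap F$ for all facets $H\ne F$ of $\Delta$. A connected simplicial complex is a simplicial tree if every nonempty subcollection of it has a leaf. Let $S$ be the polynomial ring over a field $K$ with variables $x_v$ indexed by the vertices. The facet ideal $I(\Delta)\subseteq S$ is generated by the monomials $\prod_{v\in F}x_v$, $F\in\mathcal F(\Delta)$. For a squarefree monomial ideal $I$, $I^{[k]}$ is the ideal generated by the squarefree monomials among the minimal monomial generators of $I^k$. Let $\beta_{i,j}(I)$ denote the graded Betti numbers of the minimal graded free resolution of $I$ as an $S$-module ($\beta_{0,j}(I)$ counts minimal generators of degree $j$). A homogeneous ideal $I$ generated in a single degree $e$ is linearly related if $\beta_{1,j}(I)=0$ for all $j\ne e+1$ (vacuously true for the zero ideal). *)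

theory Defs
  imports Complex_Main "HOL-Library.Poly_Mapping"
begin

section \<open>Simplicial complexes and simplicial trees\<close>

text \<open>The vertex set is the universe of a finite type; a vertex need not lie in any face.\<close>

definition simplicial_complex :: "'v::finite set set \<Rightarrow> bool" where
  "simplicial_complex D \<longleftrightarrow> D \<noteq> {} \<and> (\<forall>F\<in>D. \<forall>G. G \<subseteq> F \<longrightarrow> G \<in> D)"

definition facets :: "'v::finite set set \<Rightarrow> 'v set set" where
  "facets D = {F \<in> D. \<forall>G\<in>D. F \<subseteq> G \<longrightarrow> G = F}"

definition pure_complex :: "'v::finite set set \<Rightarrow> bool" where
  "pure_complex D \<longleftrightarrow> (\<forall>F\<in>facets D. \<forall>G\<in>facets D. card F = card G)"

definition subcollection :: "'v::finite set set \<Rightarrow> 'v set set \<Rightarrow> bool" where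
  "subcollection D' D \<longleftrightarrow> simplicial_complex D' \<and> facets D' \<subseteq> facets D"

definition leaf :: "'v::finite set set \<Rightarrow> 'v set \<Rightarrow> bool" where
  "leaf D F \<longleftrightarrow> F \<in> facets D \<and>
     (facets D = {F} \<or>
      (\<exists>G\<in>facets D. G \<noteq> F \<and> (\<forall>H\<in>facets D. H \<noteq> F \<longrightarrow> H \<inter> F \<subseteq> G \<inter> F)))"

text \<open>Any two facets are joined by a chain of facets in which consecutive ones intersect.\<close>

definition connected_complex :: "'v::finite set set \<Rightarrow> bool" where
  "connected_complex D \<longleftrightarrow>
     (\<forall>F\<in>facets D. \<forall>G\<in>facets D.
        (F, G) \<in> {(A, B). A \<in> facets D \<and> B \<in> facets D \<and> A \<inter> B \<noteq> {}}\<^sup>*)"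

definition simplicial_tree :: "'v::finite set set \<Rightarrow> bool" where
  "simplicial_tree D \<longleftrightarrow> simplicial_complex D \<and> connected_complex D \<and>
     (\<forall>D'. subcollection D' D \<and> facets D' \<noteq> {} \<longrightarrow> (\<exists>F. leaf D' F))"

section \<open>The polynomial ring and its ideals\<close>

text \<open>
  Exponent vectors are finitely supported functions from the variables to the natural numbers,
  polynomials are finitely supported functions from exponent vectors to the field; the
  multiplication that the library puts on the latter is convolution, i.e. the multiplication
  of the polynomial ring.
\<close>

type_synonym 'v expo = "'v \<Rightarrow>\<^sub>0 nat"
type_synonym ('v, 'k) mpoly = "('v \<Rightarrow>\<^sub>0 nat) \<Rightarrow>\<^sub>0 'k"

definition expo_deg :: "'v::finite expo \<Rightarrow> nat" where
  "expo_deg a = (\<Sum>v\<in>UNIV. Poly_Mapping.lookup a v)"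

definition monom :: "'v expo \<Rightarrow> ('v, 'k::field) mpoly" where
  "monom a = Poly_Mapping.single a 1"

definition var :: "'v \<Rightarrow> ('v, 'k::field) mpoly" where
  "var v = monom (Poly_Mapping.single v 1)"

text \<open>The zero polynomial is homogeneous of every degree.\<close>

definition homogeneous :: "('v::finite, 'k::field) mpoly \<Rightarrow> nat \<Rightarrow> bool" where
  "homogeneous p d \<longleftrightarrow> (\<forall>a\<in>Poly_Mapping.keys p. expo_deg a = d)"

text \<open>The span in a commutative ring, as a module over itself, is the generated ideal.\<close>

definition ideal_gen :: "'a::comm_ring_1 set \<Rightarrow> 'a set" where
  "ideal_gen B = module.span (*) B"

primrec ideal_power :: "'a::comm_ring_1 set \<Rightarrow> nat \<Rightarrow> 'a set" where
  "ideal_power I 0 = UNIV"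
| "ideal_power I (Suc n) = ideal_gen {p * q | p q. p \<in> I \<and> q \<in> ideal_power I n}"

definition facet_ideal :: "'v::finite set set \<Rightarrow> ('v, 'k::field) mpoly set" where
  "facet_ideal D = ideal_gen ((\<lambda>F. \<Prod>v\<in>F. var v) ` facets D)"

text \<open>
  For a monomial ideal, the minimal monomial generators are the monomials in the ideal that
  are minimal with respect to divisibility.
\<close>

definition min_monomial_gens :: "('v, 'k::field) mpoly set \<Rightarrow> ('v, 'k) mpoly set" where
  "min_monomial_gens J =
     {u \<in> range monom \<inter> J. \<forall>w \<in> range monom \<inter> J. w dvd u \<longrightarrow> w = u}"

definition squarefree_monomials :: "('v, 'k::field) mpoly set" where
  "squarefree_monomials = monom ` {a. \<forall>v. Poly_Mapping.lookup a v \<le> 1}"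

definition squarefree_power :: "('v, 'k::field) mpoly set \<Rightarrow> nat \<Rightarrow> ('v, 'k) mpoly set" where
  "squarefree_power I k = ideal_gen (min_monomial_gens (ideal_power I k) \<inter> squarefree_monomials)"

section \<open>Minimal graded free resolutions and graded Betti numbers\<close>

definition irrelevant_ideal :: "('v, 'k::field) mpoly set" where
  "irrelevant_ideal = ideal_gen (range var)"

text \<open>
  A graded free module is given by a set \<open>B\<close> of indices of basis elements together with their
  degrees; its elements are the finitely supported coordinate vectors with support in \<open>B\<close>.
\<close>

type_synonym ('v, 'k) fvec = "nat \<Rightarrow>\<^sub>0 ('v, 'k) mpoly"

definition free_module :: "nat set \<Rightarrow> ('v, 'k::field) fvec set" where
  "free_module B = {x. Poly_Mapping.keys x \<subseteq> B}"

definition fvec_homogeneous ::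
    "(nat \<Rightarrow> nat) \<Rightarrow> ('v::finite, 'k::field) fvec \<Rightarrow> nat \<Rightarrow> bool" where
  "fvec_homogeneous dg x d \<longleftrightarrow>
     (\<forall>b. \<forall>a\<in>Poly_Mapping.keys (Poly_Mapping.lookup x b). expo_deg a + dg b = d)"

definition fvec_scale :: "('v, 'k::field) mpoly \<Rightarrow> ('v, 'k) fvec \<Rightarrow> ('v, 'k) fvec" where
  "fvec_scale s x = Poly_Mapping.map ((*) s) x"

text \<open>The linear map sending the basis element with index \<open>b\<close> to \<open>g b\<close>.\<close>

definition linear_ext ::
    "(('v, 'k::field) mpoly \<Rightarrow> 'm \<Rightarrow> 'm::ab_group_add) \<Rightarrow> (nat \<Rightarrow> 'm) \<Rightarrow> ('v, 'k) fvec \<Rightarrow> 'm" where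
  "linear_ext scale g x =
     (\<Sum>b\<in>Poly_Mapping.keys x. scale (Poly_Mapping.lookup x b) (g b))"

text \<open>
  The data of a sequence \<open>\<dots> \<rightarrow> F\<^sub>2 \<rightarrow> F\<^sub>1 \<rightarrow> F\<^sub>0 \<rightarrow> S\<close>: bases and degrees of the \<open>F\<^sub>i\<close>, the images
  \<open>res_diff i b\<close> in \<open>F\<^sub>i\<close> of the basis elements of \<open>F\<^sub>i\<^sub>+\<^sub>1\<close>, and the images \<open>res_aug b\<close> in \<open>S\<close>
  of the basis elements of \<open>F\<^sub>0\<close>.
\<close>

record (overloaded) ('v, 'k::zero) free_res =
  res_basis :: "nat \<Rightarrow> nat set"
  res_deg :: "nat \<Rightarrow> nat \<Rightarrow> nat"
  res_diff :: "nat \<Rightarrow> nat \<Rightarrow> ('v, 'k) fvec"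
  res_aug :: "nat \<Rightarrow> ('v, 'k) mpoly"

abbreviation res_module :: "('v, 'k::field) free_res \<Rightarrow> nat \<Rightarrow> ('v, 'k) fvec set" where
  "res_module R i \<equiv> free_module (res_basis R i)"

abbreviation res_map :: "('v, 'k::field) free_res \<Rightarrow> nat \<Rightarrow> ('v, 'k) fvec \<Rightarrow> ('v, 'k) fvec" where
  "res_map R i \<equiv> linear_ext fvec_scale (res_diff R i)"

abbreviation res_aug_map :: "('v, 'k::field) free_res \<Rightarrow> ('v, 'k) fvec \<Rightarrow> ('v, 'k) mpoly" where
  "res_aug_map R \<equiv> linear_ext (*) (res_aug R)"

text \<open>
  The free modules are required to have finitely many basis elements in each degree. For a
  minimal resolution over the Noetherian ring \<open>S\<close> they are then automatically of finite rank.
\<close>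

definition graded_free_resolution ::
    "('v::finite, 'k::field) free_res \<Rightarrow> ('v, 'k) mpoly set \<Rightarrow> bool" where
  "graded_free_resolution R I \<longleftrightarrow>
     (\<forall>i j. finite {b \<in> res_basis R i. res_deg R i b = j}) \<and>
     (\<forall>b\<in>res_basis R 0. homogeneous (res_aug R b) (res_deg R 0 b)) \<and>
     (\<forall>i. \<forall>b\<in>res_basis R (Suc i).
        res_diff R i b \<in> res_module R i \<and>
        fvec_homogeneous (res_deg R i) (res_diff R i b) (res_deg R (Suc i) b)) \<and>
     res_aug_map R ` res_module R 0 = I \<and>
     {x \<in> res_module R 0. res_aug_map R x = 0} = res_map R 0 ` res_module R 1 \<and>
     (\<forall>i. {x \<in> res_module R (Suc i). res_map R i x = 0}
            = res_map R (Suc i) ` res_module R (Suc (Suc i)))"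

definition minimal_graded_free_resolution ::
    "('v::finite, 'k::field) free_res \<Rightarrow> ('v, 'k) mpoly set \<Rightarrow> bool" where
  "minimal_graded_free_resolution R I \<longleftrightarrow> graded_free_resolution R I \<and>
     (\<forall>i. \<forall>b\<in>res_basis R (Suc i). \<forall>c.
        Poly_Mapping.lookup (res_diff R i b) c \<in> irrelevant_ideal)"

text \<open>
  A homogeneous ideal has a minimal graded free resolution, unique up to isomorphism, so the
  choice of the resolution is immaterial.
\<close>

definition graded_betti :: "nat \<Rightarrow> nat \<Rightarrow> ('v::finite, 'k::field) mpoly set \<Rightarrow> nat" where
  "graded_betti i j I =
     (let R = (SOME R. minimal_graded_free_resolution R I)
      in card {b \<in> res_basis R i. res_deg R i b = j})"

definition generated_in_degree :: "('v::finite, 'k::field) mpoly set \<Rightarrow> nat \<Rightarrow> bool" where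
  "generated_in_degree I e \<longleftrightarrow> (\<exists>G. (\<forall>p\<in>G. homogeneous p e) \<and> I = ideal_gen G)"

definition linearly_related :: "('v::finite, 'k::field) mpoly set \<Rightarrow> bool" where
  "linearly_related I \<longleftrightarrow>
     I = {0} \<or> (\<exists>e. generated_in_degree I e \<and> (\<forall>j. j \<noteq> e + 1 \<longrightarrow> graded_betti 1 j I = 0))"

end

theory Submission
  imports Defs "HOL-Library.Nat_Bijection"
begin

text \<open>
  Let all facets have \<open>d\<close> elements, and call two sets in a family of sets of size \<open>e\<close> adjacent if
  their union has at most \<open>e + 1\<close> elements. The squarefree power \<open>I(\<Delta>)\<^sup>[\<^sup>n\<^sup>]\<close> is generated by the
  monomials of the unions of \<open>n\<close> disjoint facets (\<open>squarefree_power_facet_ideal\<close>). It is linearly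
  related if and only if any two such unions \<open>A\<close>, \<open>B\<close> are joined by a path of adjacent unions inside
  \<open>A \<union> B\<close>. This is the case \<open>G = set_expo ` \<U>\<close> of a criterion for monomial ideals generated in
  one degree (\<open>linearly_related_monomial_ideal_iff\<close>, \<open>linearly_connected_iff\<close>).

  The criterion makes the theorem short. If two unions of \<open>k + 1\<close> disjoint facets have a facet in
  common, remove it, join the rest by a path for \<open>k\<close> and put it back
  (\<open>connected_if_common_facet\<close>). For arbitrary unions \<open>A\<close> and \<open>B\<close> of \<open>k + 1\<close> disjoint facets, consider
  the subcollection spanned by all facets used. It has a leaf \<open>F\<close>, say from \<open>A\<close>. By disjointness
  \<open>F\<close> meets at most one facet \<open>G\<close> used in \<open>B\<close>, and exchanging \<open>G\<close> for \<open>F\<close> gives a union \<open>B'\<close> of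
  disjoint facets inside \<open>A \<union> B\<close>. It shares \<open>F\<close> with \<open>A\<close> and, since \<open>k \<ge> 1\<close>, another facet with \<open>B\<close>;
  so \<open>A\<close> is joined to \<open>B'\<close> and \<open>B'\<close> to \<open>B\<close> (\<open>connected_if_leaf\<close>).

  The criterion compares an arbitrary minimal resolution with the relations between the
  monomial generators. In one direction, the relations along a path generate the relation between
  its end points, so a minimal syzygy of another degree would be redundant
  (\<open>linear_relations_if_connected\<close>). In the other direction, restricting the augmentation to one
  connected component of generators annihilates the linear syzygies in the relevant multidegrees but
  not a relation between different components (\<open>connected_if_linear_relations\<close>).

  The graded Betti numbers refer to a chosen minimal graded free resolution, so its existence has to
  be shown as well (\<open>ex_minimal_graded_free_resolution\<close>). It is constructed degree by degree, by
  linear algebra over the field.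
\<close>

abbreviation lookup :: "('a \<Rightarrow>\<^sub>0 'b::zero) \<Rightarrow> 'a \<Rightarrow> 'b" where
  "lookup \<equiv> Poly_Mapping.lookup"
abbreviation keys :: "('a \<Rightarrow>\<^sub>0 'b::zero) \<Rightarrow> 'a set" where
  "keys \<equiv> Poly_Mapping.keys"
abbreviation single :: "'a \<Rightarrow> 'b::zero \<Rightarrow> 'a \<Rightarrow>\<^sub>0 'b" where
  "single \<equiv> Poly_Mapping.single"

section \<open>Exponents and coefficients of polynomials\<close>

definition adds :: "'v expo \<Rightarrow> 'v expo \<Rightarrow> bool" (infix "adds" 50) where
  "a adds b \<longleftrightarrow> (\<exists>c. b = a + c)"

lemma adds_refl [simp]: "a adds a"
  unfolding adds_def by (metis add.right_neutral)

lemma adds_trans: "a adds b \<Longrightarrow> b adds c \<Longrightarrow> a adds c"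
  unfolding adds_def by (metis add.assoc)

lemma expo_deg_0 [simp]: "expo_deg 0 = 0"
  by (simp add: expo_deg_def)

lemma expo_deg_add: "expo_deg (a + b) = expo_deg a + expo_deg b"
  by (simp add: expo_deg_def lookup_add sum.distrib)

lemma expo_deg_single [simp]: "expo_deg (single v n) = n"
  by (simp add: expo_deg_def lookup_single when_def)

lemma expo_deg_eq_0_iff [simp]: "expo_deg a = 0 \<longleftrightarrow> a = 0"
  by (auto simp: expo_deg_def intro: poly_mapping_eqI)

lemma adds_deg_le: "a adds b \<Longrightarrow> expo_deg a \<le> expo_deg b"
  by (auto simp: adds_def expo_deg_add)

lemma adds_same_deg: "a adds b \<Longrightarrow> expo_deg b \<le> expo_deg a \<Longrightarrow> a = b"
  by (auto simp: adds_def expo_deg_add)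

lemma expo_eq_single_add:
  assumes "a \<noteq> (0 :: 'v::finite expo)"
  obtains v c where "a = single v 1 + c"
proof -
  from assms obtain v where v: "lookup a v \<noteq> 0"
    by (metis lookup_zero poly_mapping_eqI)
  have "a = single v 1 + (a - single v 1)"
    by (rule poly_mapping_eqI) (use v in \<open>auto simp: lookup_add lookup_minus lookup_single when_def\<close>)
  then show ?thesis using that by blast
qed

lemma finite_expo_deg_eq: "finite {a :: 'v::finite expo. expo_deg a = n}"
proof (rule inj_on_finite[where f = lookup])
  show "inj_on lookup {a :: 'v expo. expo_deg a = n}"
    by (metis inj_onI poly_mapping_eqI)
  show "lookup ` {a :: 'v expo. expo_deg a = n} \<subseteq> {f. (\<forall>x. (x \<in> UNIV \<longrightarrow> f x \<in> {..n}) \<and> (x \<notin> UNIV \<longrightarrow> f x = 0))}"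
    by (auto simp: expo_deg_def intro!: member_le_sum)
  show "finite {f :: 'v \<Rightarrow> nat. (\<forall>x. (x \<in> UNIV \<longrightarrow> f x \<in> {..n}) \<and> (x \<notin> UNIV \<longrightarrow> f x = 0))}"
    by (rule finite_set_of_finite_funs) auto
qed

lemma poly_mapping_eq_sum_single: "(p :: 'a \<Rightarrow>\<^sub>0 'b::comm_monoid_add) = (\<Sum>a\<in>keys p. single a (lookup p a))"
proof (rule poly_mapping_eqI)
  fix a
  show "lookup p a = lookup (\<Sum>a\<in>keys p. single a (lookup p a)) a"
    by (simp add: lookup_sum lookup_single when_def in_keys_iff)
qed

lemma lookup_times_eq_0:
  fixes p q :: "('v, 'k::field) mpoly"
  assumes "\<And>a h. m = a + h \<Longrightarrow> a \<in> keys p \<Longrightarrow> h \<in> keys q \<Longrightarrow> False"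
  shows "lookup (p * q) m = 0"
proof (rule ccontr)
  assume "lookup (p * q) m \<noteq> 0"
  then have "m \<in> keys (p * q)" by (simp add: in_keys_iff)
  then show False using keys_mult[of p q] assms by blast
qed

lemma lookup_single_times:
  fixes q :: "('v, 'k::field) mpoly"
  shows "lookup (single a c * q) (a + b) = c * lookup q b"
proof -
  have "lookup (single a c * q) (a + b) = lookup (\<Sum>h\<in>keys q. single (a + h) (c * lookup q h)) (a + b)"
    by (subst (1) poly_mapping_eq_sum_single[of q]) (simp add: sum_distrib_left mult_single)
  also have "\<dots> = (\<Sum>h\<in>keys q. if h = b then c * lookup q h else 0)"
    by (simp add: lookup_sum lookup_single when_def)
  also have "\<dots> = c * lookup q b"
    by (simp add: in_keys_iff)
  finally show ?thesis .
qed

lemma keys_monom_mult: "keys (single a c * (q :: ('v, 'k::field) mpoly)) \<subseteq> (\<lambda>h. a + h) ` keys q"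
  using keys_mult[of "single a c" q] by (auto split: if_splits)

lemma lookup_times_0: "lookup (p * (q :: ('v::finite, 'k::field) mpoly)) 0 = lookup p 0 * lookup q 0"
proof -
  let ?r = "p - single 0 (lookup p 0)"
  have *: "(0::'v expo) = a + h \<Longrightarrow> a = 0" for a h
    by (metis add_eq_0_iff_both_eq_0 expo_deg_0 expo_deg_add expo_deg_eq_0_iff)
  have "lookup (?r * q) 0 = 0"
  proof (rule lookup_times_eq_0)
    fix a h assume "0 = a + h" "a \<in> keys ?r"
    with *[of a h] show False by (simp add: in_keys_iff lookup_minus)
  qed
  moreover have "p * q = ?r * q + single 0 (lookup p 0) * q"
    by (simp add: algebra_simps)
  ultimately show ?thesis
    using lookup_single_times[of 0 "lookup p 0" q 0] by (simp add: lookup_add)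
qed

definition restrict_poly :: "'a set \<Rightarrow> ('a \<Rightarrow>\<^sub>0 'b::zero) \<Rightarrow> 'a \<Rightarrow>\<^sub>0 'b" where
  "restrict_poly A p = Abs_poly_mapping (\<lambda>a. lookup p a when a \<in> A)"

lemma lookup_restrict_poly [simp]: "lookup (restrict_poly A p) a = (lookup p a when a \<in> A)"
proof -
  have "finite {a. (lookup p a when a \<in> A) \<noteq> 0}"
    by (rule finite_subset[OF _ finite_lookup[of p]]) (auto simp: when_def)
  then show ?thesis by (simp add: restrict_poly_def)
qed

section \<open>Ideals and free modules\<close>

interpretation ideal: module "(*) :: 'a::comm_ring_1 \<Rightarrow> 'a \<Rightarrow> 'a"
  by unfold_locales (auto simp: algebra_simps)

(* Oriented against mult.assoc, so the simplifier would loop on products. *)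
declare ideal.scale_scale [simp del]

lemma lookup_fvec_scale [simp]: "lookup (fvec_scale s x) b = s * lookup x b"
  by (simp add: fvec_scale_def Poly_Mapping.map.rep_eq when_def)

lemma keys_fvec_scale: "keys (fvec_scale s x) \<subseteq> keys x"
  by (auto simp: in_keys_iff)

interpretation fvec: module "fvec_scale :: ('v, 'k::field) mpoly \<Rightarrow> ('v, 'k) fvec \<Rightarrow> ('v, 'k) fvec"
  proof (unfold_locales, goal_cases)
  case (1 a x y) show ?case by (rule poly_mapping_eqI) (simp only: lookup_add lookup_fvec_scale distrib_left)
next
  case (2 a b x) show ?case by (rule poly_mapping_eqI) (simp only: lookup_add lookup_fvec_scale distrib_right)
next
  case (3 a b x) show ?case by (rule poly_mapping_eqI) (simp only: lookup_add lookup_fvec_scale mult.assoc)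
next
  case (4 x) show ?case by (rule poly_mapping_eqI) (simp only: lookup_fvec_scale mult_1_left)
qed

text \<open>
  Restricting the scalars to the constants turns a free module into a vector space over the field.
  Bases of its graded parts supply the minimal generators of submodules.
\<close>

interpretation kvec: vector_space "\<lambda>c. fvec_scale (single 0 c) :: ('v, 'k::field) fvec \<Rightarrow> ('v, 'k) fvec"
  by unfold_locales (auto simp: single_add fvec.scale_left_distrib fvec.scale_right_distrib mult_single)

lemma linear_ext_eq_sum:
  assumes "module scale" "finite A" "keys x \<subseteq> A"
  shows "linear_ext scale g x = (\<Sum>b\<in>A. scale (lookup x b) (g b))"
  unfolding linear_ext_def
  by (rule sum.mono_neutral_left) (use assms in \<open>auto simp: in_keys_iff module.scale_zero_left\<close>)

lemma module_hom_linear_ext: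
  fixes scale :: "('v, 'k::field) mpoly \<Rightarrow> 'm::ab_group_add \<Rightarrow> 'm"
  assumes "module scale"
  shows "module_hom fvec_scale scale (linear_ext scale g)"
proof -
  interpret m: module scale by fact
  note * = linear_ext_eq_sum[OF assms]
  show ?thesis
  proof
    fix x y :: "('v, 'k) fvec" and s
    let ?A = "keys x \<union> keys y"
    show "linear_ext scale g (x + y) = linear_ext scale g x + linear_ext scale g y"
      using *[of ?A x g] *[of ?A y g] *[of ?A "x + y" g] Poly_Mapping.keys_add[of x y]
      by (simp add: lookup_add m.scale_left_distrib sum.distrib)
    show "linear_ext scale g (fvec_scale s x) = scale s (linear_ext scale g x)"
      using *[of "keys x" x g] *[of "keys x" "fvec_scale s x" g] keys_fvec_scale[of s x]
      by (simp add: m.scale_sum_right)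
  qed
qed

interpretation fhom: module_hom fvec_scale fvec_scale "linear_ext fvec_scale g" for g :: "nat \<Rightarrow> ('v, 'k::field) fvec"
  by (rule module_hom_linear_ext) unfold_locales

interpretation phom: module_hom fvec_scale "(*)" "linear_ext (*) g" for g :: "nat \<Rightarrow> ('v, 'k::field) mpoly"
  by (rule module_hom_linear_ext) unfold_locales

abbreviation unit_vec :: "nat \<Rightarrow> ('v, 'k::field) fvec" where
  "unit_vec b \<equiv> single b 1"

lemma linear_ext_unit_vec [simp]:
  "linear_ext fvec_scale g (unit_vec b) = g b" "linear_ext (*) h (unit_vec b) = h b"
  by (simp_all add: linear_ext_def)

lemma lookup_linear_ext: "lookup (linear_ext fvec_scale g x) b = linear_ext (*) (\<lambda>c. lookup (g c) b) x"
  by (simp add: linear_ext_def lookup_sum)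

lemma linear_ext_unit_vecs: "linear_ext fvec_scale unit_vec x = x"
  by (rule poly_mapping_eqI)
     (simp add: linear_ext_def lookup_sum lookup_single when_def in_keys_iff if_distrib[of "(*) _"] cong: if_cong)

lemma subspace_free_module: "fvec.subspace (free_module B)"
proof (rule fvec.subspaceI)
  fix x y :: "('v, 'k::field) fvec" assume "x \<in> free_module B" "y \<in> free_module B"
  then show "x + y \<in> free_module B"
    using Poly_Mapping.keys_add[of x y] by (auto simp: free_module_def)
qed (use keys_fvec_scale in \<open>force simp: free_module_def\<close>)+

lemma linear_ext_mem:
  assumes "fvec.subspace M" "\<And>b. b \<in> B \<Longrightarrow> g b \<in> M" "x \<in> free_module B"
  shows "linear_ext fvec_scale g x \<in> M"
  unfolding linear_ext_def
  using assms by (auto simp: free_module_def intro!: fvec.subspace_sum fvec.subspace_scale)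

section \<open>The grading\<close>

definition hom_part :: "(nat \<Rightarrow> nat) \<Rightarrow> nat \<Rightarrow> ('v::finite, 'k::field) fvec \<Rightarrow> ('v, 'k) fvec" where
  "hom_part dg d x = Abs_poly_mapping (\<lambda>b. restrict_poly {a. expo_deg a + dg b = d} (lookup x b))"

lemma lookup_hom_part [simp]:
  "lookup (hom_part dg d x) b = restrict_poly {a. expo_deg a + dg b = d} (lookup x b)"
proof -
  have "finite {b. restrict_poly {a. expo_deg a + dg b = d} (lookup x b) \<noteq> 0}"
    by (rule finite_subset[OF _ finite_lookup[of x]]) (auto intro!: poly_mapping_eqI)
  then show ?thesis by (simp add: hom_part_def)
qed

lemma fvec_homogeneous_iff:
  "fvec_homogeneous dg x d \<longleftrightarrow> (\<forall>b a. lookup (lookup x b) a \<noteq> 0 \<longrightarrow> expo_deg a + dg b = d)"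
  by (auto simp: fvec_homogeneous_def in_keys_iff)

lemma hom_part_homogeneous: "fvec_homogeneous dg (hom_part dg d x) d"
  by (auto simp: fvec_homogeneous_iff)

lemma hom_part_eq_self: "fvec_homogeneous dg x d \<Longrightarrow> hom_part dg d x = x"
  by (intro poly_mapping_eqI) (force simp: fvec_homogeneous_iff when_def)

lemma hom_part_eq_0: "fvec_homogeneous dg x d' \<Longrightarrow> d' \<noteq> d \<Longrightarrow> hom_part dg d x = 0"
  by (intro poly_mapping_eqI) (force simp: fvec_homogeneous_iff when_def)

lemma hom_part_0 [simp]: "hom_part dg d 0 = 0"
  by (auto intro!: poly_mapping_eqI)

lemma hom_part_add: "hom_part dg d (x + y) = hom_part dg d x + hom_part dg d y"
  by (auto simp: when_def lookup_add intro!: poly_mapping_eqI)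

lemma hom_part_sum: "hom_part dg d (\<Sum>i\<in>A. f i) = (\<Sum>i\<in>A. hom_part dg d (f i))"
  by (induction A rule: infinite_finite_induct) (auto simp: hom_part_add)

lemma hom_part_in_free_module: "x \<in> free_module B \<Longrightarrow> hom_part dg d x \<in> free_module B"
  unfolding free_module_def mem_Collect_eq
  by (erule subset_trans[rotated]) (auto simp: in_keys_iff poly_mapping_eq_iff fun_eq_iff)

lemma fvec_homogeneous_add:
  "fvec_homogeneous dg x d \<Longrightarrow> fvec_homogeneous dg y d \<Longrightarrow> fvec_homogeneous dg (x + y) d"
  unfolding fvec_homogeneous_iff by (simp add: lookup_add) (metis add_0)

lemma fvec_homogeneous_scale:
  assumes "fvec_homogeneous dg x d" "homogeneous p n"
  shows "fvec_homogeneous dg (fvec_scale p x) (n + d)"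
  unfolding fvec_homogeneous_def
proof (intro allI ballI)
  fix b a assume "a \<in> keys (lookup (fvec_scale p x) b)"
  then obtain c h where "a = c + h" "c \<in> keys p" "h \<in> keys (lookup x b)"
    using keys_mult[of p "lookup x b"] by auto
  then show "expo_deg a + dg b = n + d"
    using assms by (auto simp: fvec_homogeneous_def homogeneous_def expo_deg_add)
qed

lemma sum_hom_part:
  "x = (\<Sum>d\<in>(\<Union>b\<in>keys x. (\<lambda>a. expo_deg a + dg b) ` keys (lookup x b)). hom_part dg d x)"
    (is "_ = sum _ ?D")
proof (intro poly_mapping_eqI)
  fix b a
  have fin: "finite ?D" by auto
  have "lookup (lookup (\<Sum>d\<in>?D. hom_part dg d x) b) a
      = (\<Sum>d\<in>?D. if d = expo_deg a + dg b then lookup (lookup x b) a else 0)"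
    by (simp add: lookup_sum when_def eq_commute)
  also have "\<dots> = lookup (lookup x b) a"
  proof (cases "lookup (lookup x b) a = 0")
    case False
    then have "a \<in> keys (lookup x b)" "b \<in> keys x"
      by (auto simp: in_keys_iff)
    then have "expo_deg a + dg b \<in> ?D" by blast
    then show ?thesis using fin by simp
  qed simp
  finally show "lookup (lookup x b) a = lookup (lookup (\<Sum>d\<in>?D. hom_part dg d x) b) a" ..
qed

lemma fvec_eq_sum_monomials:
  "x = (\<Sum>b\<in>keys x. \<Sum>a\<in>keys (lookup x b). fvec_scale (single a (lookup (lookup x b) a)) (unit_vec b))"
proof -
  have "x = (\<Sum>b\<in>keys x. fvec_scale (lookup x b) (unit_vec b))"
    using linear_ext_unit_vecs[of x] by (simp add: linear_ext_def)
  also have "\<dots> = (\<Sum>b\<in>keys x. fvec_scale (\<Sum>a\<in>keys (lookup x b). single a (lookup (lookup x b) a)) (unit_vec b))"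
    by (rule sum.cong) (simp_all flip: poly_mapping_eq_sum_single)
  finally show ?thesis by (simp add: fvec.scale_sum_left)
qed

lemma homogeneous_single: "homogeneous (single a c) (expo_deg a)"
  by (simp add: homogeneous_def)

lemma unit_vec_homogeneous: "fvec_homogeneous dg (unit_vec b) (dg b)"
  by (auto simp: fvec_homogeneous_iff lookup_single when_def lookup_one)

text \<open>
  A map of graded free modules of degree zero preserves the grading: by additivity it suffices to
  look at a monomial times a basis element, which is homogeneous and has a homogeneous image of the
  same degree.
\<close>

lemma hom_part_linear_ext:
  assumes g: "\<And>b. b \<in> B \<Longrightarrow> fvec_homogeneous dg (g b) (dg' b)" and x: "x \<in> free_module B"
  shows "hom_part dg d (linear_ext fvec_scale g x) = linear_ext fvec_scale g (hom_part dg' d x)"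
proof -
  let ?c = "\<lambda>b a. single a (lookup (lookup x b) a)"
  have eq: "hom_part dg d (fvec_scale (?c b a) (g b)) =
      linear_ext fvec_scale g (hom_part dg' d (fvec_scale (?c b a) (unit_vec b)))" if "b \<in> keys x" for b a
  proof -
    from that x have b: "b \<in> B" by (auto simp: free_module_def)
    have 1: "fvec_homogeneous dg (fvec_scale (?c b a) (g b)) (expo_deg a + dg' b)"
      by (rule fvec_homogeneous_scale[OF g[OF b] homogeneous_single])
    have 2: "fvec_homogeneous dg' (fvec_scale (?c b a) (unit_vec b)) (expo_deg a + dg' b)"
      by (rule fvec_homogeneous_scale[OF unit_vec_homogeneous homogeneous_single])
    show ?thesis
    proof (cases "expo_deg a + dg' b = d")
      case True
      with hom_part_eq_self[OF 1] hom_part_eq_self[OF 2] show ?thesis by (simp add: fhom.scale)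
    next
      case False
      with hom_part_eq_0[OF 1] hom_part_eq_0[OF 2] show ?thesis by simp
    qed
  qed
  show ?thesis
    by (subst (1 2) fvec_eq_sum_monomials[of x])
       (simp add: fhom.sum hom_part_sum fhom.scale eq)
qed

section \<open>Minimal graded free resolutions exist\<close>

lemma irrelevant_ideal_iff: "p \<in> irrelevant_ideal \<longleftrightarrow> lookup (p :: ('v::finite, 'k::field) mpoly) 0 = 0"
proof
  have "irrelevant_ideal \<subseteq> {p :: ('v, 'k) mpoly. lookup p 0 = 0}"
    unfolding irrelevant_ideal_def ideal_gen_def
  proof (rule ideal.span_minimal)
    show "ideal.subspace {p :: ('v, 'k) mpoly. lookup p 0 = 0}"
      by (rule ideal.subspaceI) (auto simp: lookup_add lookup_times_0)
    have "single v (1::nat) \<noteq> 0" for v :: 'v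
      by (metis expo_deg_0 expo_deg_single zero_neq_one)
    then show "range var \<subseteq> {p :: ('v, 'k) mpoly. lookup p 0 = 0}"
      by (auto simp: var_def monom_def lookup_single when_def)
  qed
  then show "p \<in> irrelevant_ideal \<Longrightarrow> lookup p 0 = 0" by blast
next
  assume p: "lookup p 0 = 0"
  have "(\<Sum>a\<in>keys p. single a (lookup p a)) \<in> irrelevant_ideal"
    unfolding irrelevant_ideal_def ideal_gen_def
  proof (rule ideal.span_sum)
    fix a assume "a \<in> keys p"
    with p have "a \<noteq> 0" by (auto simp: in_keys_iff)
    then obtain v c where "a = single v 1 + c" using expo_eq_single_add by blast
    then have "single a (lookup p a) = single c (lookup p a) * var v"
      by (simp add: var_def monom_def mult_single add.commute)
    then show "single a (lookup p a) \<in> ideal.span (range var)"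
      by (metis ideal.span_base ideal.span_scale rangeI)
  qed
  then show "p \<in> irrelevant_ideal" using poly_mapping_eq_sum_single[of p] by simp
qed

text \<open>
  Extend a basis of \<open>N\<close> to one of \<open>M\<close>; the added vectors span \<open>M\<close> modulo \<open>N\<close> and are independent
  modulo \<open>N\<close>. With \<open>N\<close> the decomposable part of a graded piece \<open>M\<close>, these are the minimal
  generators in that degree, as in the graded Nakayama lemma.
\<close>

lemma (in vector_space) finite_basis_of_complement:
  assumes N: "subspace N" and M: "subspace M" "N \<subseteq> M" "M \<subseteq> span T" and T: "finite T"
  shows "\<exists>e (n::nat). (\<forall>i<n. e i \<in> M) \<and> (\<forall>x\<in>M. \<exists>c. x - (\<Sum>i<n. c i *s e i) \<in> N) \<and>
    (\<forall>c. (\<Sum>i<n. c i *s e i) \<in> N \<longrightarrow> (\<forall>i<n. c i = 0))"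
proof -
  obtain A where A: "A \<subseteq> N" "independent A" "N \<subseteq> span A"
    using maximal_independent_subset by metis
  obtain A' where A': "A \<subseteq> A'" "A' \<subseteq> M" "independent A'" "M \<subseteq> span A'"
    using maximal_independent_subset_extend[of A M] A M by blast
  have fin': "finite A'" using independent_span_bound[OF T A'(3)] A' M by blast
  then have fin: "finite A" using A' finite_subset by blast
  obtain n :: nat and h where h: "bij_betw h {..<n} (A' - A)"
    using ex_bij_betw_nat_finite[of "A' - A"] fin' by (auto simp: atLeast0LessThan)
  have split: "(\<Sum>v\<in>A'. f v) = (\<Sum>v\<in>A. f v) + (\<Sum>i<n. f (h i))" for f :: "'b \<Rightarrow> 'b"
    using sum.subset_diff[OF A'(1) fin', of f] sum.reindex_bij_betw[OF h, of f] by (simp add: add.commute)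
  show ?thesis
  proof (intro exI[of _ h] exI[of _ n] conjI allI impI ballI)
    fix i assume "i < n" then show "h i \<in> M" using h A' by (auto simp: bij_betw_def)
  next
    fix x assume "x \<in> M"
    with A' have "x \<in> span A'" by blast
    then obtain u where u: "x = (\<Sum>v\<in>A'. u v *s v)" using span_finite[OF fin'] by auto
    have "x - (\<Sum>i<n. u (h i) *s h i) = (\<Sum>v\<in>A. u v *s v)"
      unfolding u split by simp
    also have "\<dots> \<in> N" using A N by (auto intro!: subspace_sum subspace_scale)
    finally show "\<exists>c. x - (\<Sum>i<n. c i *s h i) \<in> N" by (intro exI[of _ "\<lambda>i. u (h i)"])
  next
    fix c i assume "(\<Sum>i<n. c i *s h i) \<in> N" and i: "i < n"
    then have "(\<Sum>i<n. c i *s h i) \<in> span A" using A by blast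
    then obtain u where u: "(\<Sum>i<n. c i *s h i) = (\<Sum>v\<in>A. u v *s v)" using span_finite[OF fin] by auto
    define w where "w v = (if v \<in> A then - u v else c (the_inv_into {..<n} h v))" for v
    have "w (h i) = c i" if "i < n" for i
      using h that by (auto simp: w_def bij_betw_def the_inv_into_f_f)
    then have "(\<Sum>v\<in>A'. w v *s v) = 0"
      unfolding split using u by (simp add: w_def sum_negf)
    moreover have "h i \<in> A'" using h i by (auto simp: bij_betw_def)
    ultimately have "w (h i) = 0" using independentD[OF A'(3) fin'] by blast
    then show "c i = 0" using \<open>\<And>i. i < n \<Longrightarrow> w (h i) = c i\<close>[OF i] by simp
  qed
qed

definition graded_submodule :: "(nat \<Rightarrow> nat) \<Rightarrow> ('v::finite, 'k::field) fvec set \<Rightarrow> bool" where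
  "graded_submodule dg M \<longleftrightarrow> fvec.subspace M \<and> (\<forall>x\<in>M. \<forall>d. hom_part dg d x \<in> M)"

text \<open>
  One step of a minimal resolution: a graded free module on \<open>B'\<close> mapping onto the submodule \<open>M\<close>
  such that every relation between the chosen generators has coefficients in the irrelevant ideal.
  The finiteness condition is what allows the next step to be carried out.
\<close>

definition minimal_cover ::
    "(nat \<Rightarrow> nat) \<Rightarrow> ('v::finite, 'k::field) fvec set \<Rightarrow>
     nat set \<Rightarrow> (nat \<Rightarrow> nat) \<Rightarrow> (nat \<Rightarrow> ('v, 'k) fvec) \<Rightarrow> bool" where
  "minimal_cover dg M B' dg' g \<longleftrightarrow>
     (\<forall>j. finite {b \<in> B'. dg' b = j}) \<and>
     (\<forall>b\<in>B'. fvec_homogeneous dg (g b) (dg' b)) \<and>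
     linear_ext fvec_scale g ` free_module B' = M \<and>
     (\<forall>x\<in>free_module B'. linear_ext fvec_scale g x = 0 \<longrightarrow> (\<forall>b. lookup x b \<in> irrelevant_ideal))"

lemma minimal_coverD:
  assumes "minimal_cover dg M B' dg' g"
  shows "\<forall>j. finite {b \<in> B'. dg' b = j}"
    and "\<forall>b\<in>B'. fvec_homogeneous dg (g b) (dg' b)"
    and "linear_ext fvec_scale g ` free_module B' = M"
    and "\<forall>x\<in>free_module B'. linear_ext fvec_scale g x = 0 \<longrightarrow> (\<forall>b. lookup x b \<in> irrelevant_ideal)"
  using assms unfolding minimal_cover_def by simp_all

lemma kvec_subspace: "fvec.subspace M \<Longrightarrow> kvec.subspace M"
  by (simp add: fvec.subspace_def kvec.subspace_def)

lemma unit_vec_in_free_module: "b \<in> B \<Longrightarrow> unit_vec b \<in> free_module B"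
  by (simp add: free_module_def)

lemma homogeneous_part_subset_finite_span:
  fixes dg :: "nat \<Rightarrow> nat" and B :: "nat set"
  assumes fin: "\<And>j. finite {b \<in> B. dg b = j}"
  shows "\<exists>T. finite T \<and> {x \<in> free_module B. fvec_homogeneous dg x d} \<subseteq> kvec.span (T :: ('v::finite, 'k::field) fvec set)"
proof -
  define T :: "('v, 'k) fvec set" where "T = (\<lambda>(b, a). fvec_scale (single a 1) (unit_vec b)) `
     ((\<Union>j\<le>d. {b \<in> B. dg b = j}) \<times> (\<Union>j\<le>d. {a :: 'v expo. expo_deg a = j}))"
  have "finite T"
    unfolding T_def using fin finite_expo_deg_eq by (intro finite_imageI finite_cartesian_product) auto
  moreover have "x \<in> kvec.span T" if x: "x \<in> free_module B" "fvec_homogeneous dg x d" for x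
  proof -
    have "(\<Sum>b\<in>keys x. \<Sum>a\<in>keys (lookup x b). fvec_scale (single a (lookup (lookup x b) a)) (unit_vec b)) \<in> kvec.span T"
    proof (intro kvec.span_sum)
      fix b a assume b: "b \<in> keys x" and a: "a \<in> keys (lookup x b)"
      have "expo_deg a + dg b = d" "b \<in> B"
        using a b x by (auto simp: fvec_homogeneous_def free_module_def)
      then have "fvec_scale (single a 1) (unit_vec b) \<in> T"
        unfolding T_def by (intro image_eqI[of _ _ "(b, a)"]) auto
      moreover have "fvec_scale (single a c) (unit_vec b) =
         fvec_scale (single 0 c) (fvec_scale (single a 1) (unit_vec b))" for c :: 'k
        by (simp add: mult_single)
      ultimately show "fvec_scale (single a (lookup (lookup x b) a)) (unit_vec b) \<in> kvec.span T"
        using kvec.span_base kvec.span_scale by metis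
    qed
    then show ?thesis using fvec_eq_sum_monomials[of x] by simp
  qed
  ultimately show ?thesis by blast
qed

lemma var_homogeneous: "homogeneous (var v) 1"
  using homogeneous_single[of "single v 1"] by (simp add: var_def monom_def)

text \<open>
  In degree \<open>d\<close> choose representatives of a basis of \<open>M\<^sub>d\<close> modulo the part \<open>N\<^sub>d\<close> generated by
  products of variables with \<open>M\<^sub>d\<^sub>-\<^sub>1\<close>. Induction on the degree shows that all these elements
  together generate \<open>M\<close>. In a relation between them, the part of degree \<open>d\<close> is a combination with
  constant coefficients of the generators of degree \<open>d\<close> plus an element of \<open>N\<^sub>d\<close>, hence the
  constants vanish.
\<close>

lemma ex_minimal_cover:
  fixes M :: "('v::finite, 'k::field) fvec set"
  assumes fin: "\<And>j. finite {b \<in> B. dg b = j}"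
    and MB: "M \<subseteq> free_module B" and M: "graded_submodule dg M"
  shows "\<exists>B' dg' g. minimal_cover dg M B' dg' g"
proof -
  have subM: "fvec.subspace M" and partM: "\<And>x d. x \<in> M \<Longrightarrow> hom_part dg d x \<in> M"
    using M by (auto simp: graded_submodule_def)
  define Mh where "Mh d = {x \<in> M. fvec_homogeneous dg x d}" for d
  define S where "S d = {fvec_scale (var v) y | v y. \<exists>d'. Suc d' = d \<and> y \<in> Mh d'}" for d
  define N where "N d = kvec.span (S d)" for d
  have scaleM: "fvec_scale p y \<in> Mh (n + d)" if "y \<in> Mh d" "homogeneous p n" for p y n d
    using that subM by (auto simp: Mh_def intro: fvec_homogeneous_scale fvec.subspace_scale)
  have homk: "homogeneous (single 0 c) 0" for c :: 'k
    using homogeneous_single[of 0 c] by simp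
  have subMh: "kvec.subspace (Mh d)" for d
  proof (rule kvec.subspaceI)
    show "0 \<in> Mh d" using fvec.subspace_0[OF subM] by (simp add: Mh_def fvec_homogeneous_iff)
    show "x + y \<in> Mh d" if "x \<in> Mh d" "y \<in> Mh d" for x y
      using that fvec.subspace_add[OF subM] by (auto simp: Mh_def fvec_homogeneous_add)
    show "fvec_scale (single 0 c) x \<in> Mh d" if "x \<in> Mh d" for c x
      using scaleM[OF that homk] by simp
  qed
  have subN: "kvec.subspace (N d)" for d by (simp add: N_def)
  have "S d \<subseteq> Mh d" for d
    using scaleM[OF _ var_homogeneous] by (auto simp: S_def)
  then have NM: "N d \<subseteq> Mh d" for d
    unfolding N_def by (intro kvec.span_minimal subMh)
  have fgen: "\<exists>T. finite T \<and> Mh d \<subseteq> kvec.span T" for d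
    using homogeneous_part_subset_finite_span[OF fin, of d] MB unfolding Mh_def by blast
  define basis where "basis d e n \<longleftrightarrow> (\<forall>i<n. e i \<in> Mh d) \<and>
    (\<forall>x\<in>Mh d. \<exists>c. x - (\<Sum>i<n. fvec_scale (single 0 (c i)) (e i)) \<in> N d) \<and>
    (\<forall>c. (\<Sum>i<n. fvec_scale (single 0 (c i)) (e i)) \<in> N d \<longrightarrow> (\<forall>i<n. c i = 0))"
    for d e and n :: nat
  have "\<exists>e n. basis d e n" for d
  proof -
    obtain T where "finite T" "Mh d \<subseteq> kvec.span T"
      using fgen by blast
    then show ?thesis unfolding basis_def
      by (intro kvec.finite_basis_of_complement[OF subN subMh NM])
  qed
  then obtain e n where en: "\<And>d. basis d (e d) (n d)" by metis
  have eM: "\<And>d i. i < n d \<Longrightarrow> e d i \<in> Mh d" and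
    span: "\<And>d x. x \<in> Mh d \<Longrightarrow> \<exists>c. x - (\<Sum>i<n d. fvec_scale (single 0 (c i)) (e d i)) \<in> N d" and
    indep: "\<And>d c i. (\<Sum>i<n d. fvec_scale (single 0 (c i)) (e d i)) \<in> N d \<Longrightarrow> i < n d \<Longrightarrow> c i = 0"
    using en unfolding basis_def by blast+
  \<comment> \<open>The generator number \<open>i\<close> of degree \<open>d\<close> gets the index \<open>prod_encode (d, i)\<close>.\<close>
  define B' where "B' = {j. snd (prod_decode j) < n (fst (prod_decode j))}"
  define dg' where "dg' = (\<lambda>j. fst (prod_decode j))"
  define g where "g = (\<lambda>j. e (dg' j) (snd (prod_decode j)))"
  have fiber: "{b \<in> B'. dg' b = d} = (\<lambda>i. prod_encode (d, i)) ` {..<n d}" for d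
  proof (intro equalityI subsetI)
    fix b assume "b \<in> {b \<in> B'. dg' b = d}"
    then have "b = prod_encode (d, snd (prod_decode b)) \<and> snd (prod_decode b) < n d"
      by (auto simp: B'_def dg'_def)
    then show "b \<in> (\<lambda>i. prod_encode (d, i)) ` {..<n d}" by blast
  qed (auto simp: B'_def dg'_def)
  have gM: "g b \<in> Mh (dg' b)" if "b \<in> B'" for b
    using that eM by (auto simp: B'_def dg'_def g_def)
  let ?lin = "linear_ext fvec_scale g"
  let ?Im = "?lin ` free_module B'"
  have subIm: "fvec.subspace ?Im"
    by (rule fhom.subspace_image[OF subspace_free_module])
  have eIm: "e d i \<in> ?Im" if "i < n d" for d i
  proof (rule image_eqI)
    show "e d i = ?lin (unit_vec (prod_encode (d, i)))" by (simp add: g_def dg'_def)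
    show "unit_vec (prod_encode (d, i)) \<in> free_module B'"
      using that by (auto simp: B'_def intro: unit_vec_in_free_module)
  qed
  have MhIm: "Mh d \<subseteq> ?Im" for d
  proof (induction d rule: less_induct)
    case (less d)
    have "S d \<subseteq> ?Im"
      using less by (fastforce simp: S_def intro!: fvec.subspace_scale[OF subIm])
    then have NIm: "N d \<subseteq> ?Im"
      unfolding N_def by (intro kvec.span_minimal kvec_subspace subIm)
    show ?case
    proof
      fix x assume "x \<in> Mh d"
      then obtain c where "x - (\<Sum>i<n d. fvec_scale (single 0 (c i)) (e d i)) \<in> ?Im"
        using span[of x d] NIm by blast
      moreover have "(\<Sum>i<n d. fvec_scale (single 0 (c i)) (e d i)) \<in> ?Im"
        by (intro fvec.subspace_sum[OF subIm] fvec.subspace_scale[OF subIm] eIm) auto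
      ultimately have "x - (\<Sum>i<n d. fvec_scale (single 0 (c i)) (e d i)) + (\<Sum>i<n d. fvec_scale (single 0 (c i)) (e d i)) \<in> ?Im"
        by (rule fvec.subspace_add[OF subIm])
      then show "x \<in> ?Im" by (simp only: diff_add_cancel)
    qed
  qed
  have "?Im = M"
  proof
    show "?Im \<subseteq> M"
      using linear_ext_mem[OF subM, of B' g] gM by (auto simp: Mh_def)
    show "M \<subseteq> ?Im"
    proof
      fix x assume "x \<in> M"
      then have "hom_part dg d x \<in> ?Im" for d
        using MhIm[of d] partM[of x d] hom_part_homogeneous[of dg d x] by (auto simp: Mh_def)
      then show "x \<in> ?Im"
        by (subst sum_hom_part[of x dg]) (intro fvec.subspace_sum[OF subIm])
    qed
  qed
  \<comment> \<open>A form of positive degree is a combination of multiples of variables.\<close>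
  have MhN: "fvec_scale p y \<in> N (m + d)" if y: "y \<in> Mh d" and p: "homogeneous p m" "m > 0" for p y m d
  proof -
    have "(\<Sum>a\<in>keys p. fvec_scale (single a (lookup p a)) y) \<in> N (m + d)"
      unfolding N_def
    proof (rule kvec.span_sum)
      fix a assume "a \<in> keys p"
      with p have a: "expo_deg a = m" "a \<noteq> 0" by (auto simp: homogeneous_def)
      then obtain v c where c: "a = single v 1 + c" using expo_eq_single_add by blast
      have eq: "fvec_scale (single a k) y = fvec_scale (single 0 k) (fvec_scale (var v) (fvec_scale (single c 1) y))" for k
        by (simp add: c var_def monom_def mult_single)
      have "m = Suc (expo_deg c)" using a(1) by (simp add: c expo_deg_add)
      then have "fvec_scale (var v) (fvec_scale (single c 1) y) \<in> S (m + d)"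
        using scaleM[OF y homogeneous_single[of c 1]] by (force simp: S_def)
      then show "fvec_scale (single a (lookup p a)) y \<in> kvec.span (S (m + d))"
        unfolding eq by (intro kvec.span_scale kvec.span_base)
    qed
    then show ?thesis
      using poly_mapping_eq_sum_single[of p] by (simp flip: fvec.scale_sum_left)
  qed
  have "lookup x b \<in> irrelevant_ideal" if x: "x \<in> free_module B'" "?lin x = 0" for x b
  proof (cases "b \<in> B'")
    case False
    with x have "lookup x b = 0" by (auto simp: free_module_def in_keys_iff)
    then show ?thesis by (simp add: irrelevant_ideal_iff)
  next
    case True
    define d where "d = dg' b"
    define x' where "x' = hom_part dg' d x"
    let ?E = "{b \<in> B'. dg' b = d}"
    have homg: "\<And>b. b \<in> B' \<Longrightarrow> fvec_homogeneous dg (g b) (dg' b)"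
      using gM by (auto simp: Mh_def)
    have finE: "finite ?E" unfolding fiber by simp
    have x'B: "x' \<in> free_module B'" unfolding x'_def by (rule hom_part_in_free_module[OF x(1)])
    have "0 = ?lin x'"
      using hom_part_linear_ext[of B' dg g dg' x d, OF homg x(1)] by (simp add: x(2) x'_def)
    also have "\<dots> = (\<Sum>b\<in>keys x' \<union> ?E. fvec_scale (lookup x' b) (g b))"
      using finE by (intro linear_ext_eq_sum) (auto intro: fvec.module_axioms)
    also have "\<dots> = (\<Sum>b\<in>?E. fvec_scale (lookup x' b) (g b)) + (\<Sum>b\<in>keys x' - ?E. fvec_scale (lookup x' b) (g b))"
      using sum.union_disjoint[of ?E "keys x' - ?E"] finE by (simp add: Un_commute)
    finally have zero: "\<dots> = 0" ..
    have inN: "(\<Sum>b\<in>keys x' - ?E. fvec_scale (lookup x' b) (g b)) \<in> N d"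
      unfolding N_def
    proof (rule kvec.span_sum, fold N_def)
      fix b assume b: "b \<in> keys x' - ?E"
      then have bB: "b \<in> B'" and bd: "dg' b \<noteq> d" using x'B by (auto simp: free_module_def)
      obtain a where "a \<in> keys (lookup x' b)"
        using b by (metis DiffD1 in_keys_iff keys_eq_empty ex_in_conv)
      then have "expo_deg a + dg' b = d" by (auto simp: x'_def in_keys_iff)
      then have "d - dg' b > 0" "d - dg' b + dg' b = d" using bd by auto
      moreover have "homogeneous (lookup x' b) (d - dg' b)"
        by (auto simp: homogeneous_def x'_def in_keys_iff)
      ultimately show "fvec_scale (lookup x' b) (g b) \<in> N d"
        using MhN[OF gM[OF bB]] by metis
    qed
    have const: "lookup x' b' = single 0 (lookup (lookup x b') 0)" if "b' \<in> ?E" for b'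
      by (rule poly_mapping_eqI) (use that in \<open>auto simp: x'_def lookup_single when_def\<close>)
    have "(\<Sum>b\<in>?E. fvec_scale (lookup x' b) (g b)) = (\<Sum>b\<in>?E. fvec_scale (single 0 (lookup (lookup x b) 0)) (g b))"
      using const by simp
    also have "\<dots> = (\<Sum>i<n d. fvec_scale (single 0 (lookup (lookup x (prod_encode (d, i))) 0)) (e d i))"
      unfolding fiber by (subst sum.reindex) (auto simp: inj_on_def g_def dg'_def)
    finally have "(\<Sum>i<n d. fvec_scale (single 0 (lookup (lookup x (prod_encode (d, i))) 0)) (e d i)) =
        - (\<Sum>b\<in>keys x' - ?E. fvec_scale (lookup x' b) (g b))"
      using zero by (simp add: eq_neg_iff_add_eq_0)
    also have "\<dots> \<in> N d" by (rule kvec.subspace_neg[OF subN inN])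
    finally have c0: "i < n d \<Longrightarrow> lookup (lookup x (prod_encode (d, i))) 0 = 0" for i
      by (rule indep)
    have "b \<in> ?E" using True by (simp add: d_def)
    then show ?thesis
      using c0 unfolding fiber irrelevant_ideal_iff by blast
  qed
  then have "minimal_cover dg M B' dg' g"
    using \<open>?Im = M\<close> gM fiber by (auto simp: minimal_cover_def Mh_def)
  then show ?thesis by blast
qed

lemma graded_submodule_kernel:
  assumes "\<And>b. b \<in> B \<Longrightarrow> fvec_homogeneous dg (g b) (dg' b)"
  shows "graded_submodule dg' {x \<in> free_module B. linear_ext fvec_scale g x = 0}"
  unfolding graded_submodule_def
proof (intro conjI ballI allI)
  show "fvec.subspace {x \<in> free_module B. linear_ext fvec_scale g x = 0}"
    by (rule fvec.subspaceI)
       (auto simp: fhom.add fhom.scale intro: fvec.subspace_0 fvec.subspace_add fvec.subspace_scale subspace_free_module)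
next
  fix x d assume x: "x \<in> {x \<in> free_module B. linear_ext fvec_scale g x = 0}"
  then have "linear_ext fvec_scale g (hom_part dg' d x) = hom_part dg d (linear_ext fvec_scale g x)"
    using hom_part_linear_ext[of B dg g dg' x d] assms by simp
  with x show "hom_part dg' d x \<in> {x \<in> free_module B. linear_ext fvec_scale g x = 0}"
    by (auto simp: hom_part_in_free_module)
qed

text \<open>
  Iterate minimal covers, each time of the kernel of the previous one. The ideal enters as a
  submodule of the free module of rank one with basis index \<open>0\<close>, so that the augmentation is built
  by the same step as all the differentials.
\<close>

lemma ex_minimal_graded_free_resolution:
  fixes J :: "('v::finite, 'k::field) mpoly set"
  assumes J: "graded_submodule (\<lambda>_. 0) (single (0::nat) ` J)"
  shows "\<exists>R. minimal_graded_free_resolution R J"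
proof -
  let ?ker = "\<lambda>B g. {x \<in> free_module B. linear_ext fvec_scale g x = (0 :: ('v, 'k) fvec)}"
  let ?step = "\<lambda>(B, dg, g) (B', dg', g'). minimal_cover dg (?ker B g) B' dg' g'"
  let ?good = "\<lambda>(n::nat) (B, dg, g). (n = 0 \<longrightarrow> minimal_cover (\<lambda>_. 0) (single 0 ` J) B dg g) \<and>
     (\<forall>j. finite {b \<in> B. dg b = (j::nat)}) \<and> (\<exists>dg0. \<forall>b\<in>B. fvec_homogeneous dg0 (g b) (dg b))"
  have "\<exists>f. \<forall>n. ?good n (f n) \<and> ?step (f n) (f (Suc n))"
  proof (rule dependent_nat_choice[of ?good "\<lambda>_. ?step"])
    have "single 0 ` J \<subseteq> free_module {0}" by (auto simp: free_module_def split: if_splits)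
    then obtain B dg g where "minimal_cover (\<lambda>_. 0) (single 0 ` J) B dg g"
      using ex_minimal_cover[of "{0}" "\<lambda>_. 0" "single 0 ` J"] J by auto
    moreover note minimal_coverD(1,2)[OF this]
    ultimately show "\<exists>x. ?good 0 x"
      by (intro exI[of _ "(B, dg, g)"]) (simp, rule exI)
  next
    fix x n assume good: "?good n x"
    obtain B dg g where x: "x = (B, dg, g)" by (metis prod_cases3)
    have "graded_submodule dg (?ker B g)"
      using good graded_submodule_kernel[of B _ g dg] by (auto simp: x)
    then obtain B' dg' g' where "minimal_cover dg (?ker B g) B' dg' g'"
      using ex_minimal_cover[of B dg "?ker B g"] good by (auto simp: x)
    moreover note minimal_coverD(1,2)[OF this]
    ultimately show "\<exists>y. ?good (Suc n) y \<and> ?step x y"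
      by (intro exI[of _ "(B', dg', g')"]) (simp add: x, rule exI)
  qed
  then obtain f where all: "\<forall>n. ?good n (f n) \<and> ?step (f n) (f (Suc n))" ..
  have good: "?good n (f n)" and step: "?step (f n) (f (Suc n))" for n
    using all[rule_format, of n] by simp_all
  define B where "B n = fst (f n)" for n
  define dg where "dg n = fst (snd (f n))" for n
  define g where "g n = snd (snd (f n))" for n
  have f: "f n = (B n, dg n, g n)" for n by (simp add: B_def dg_def g_def)
  have 0: "minimal_cover (\<lambda>_. 0) (single 0 ` J) (B 0) (dg 0) (g 0)"
    using good[of 0] by (simp add: f)
  have Suc: "minimal_cover (dg n) (?ker (B n) (g n)) (B (Suc n)) (dg (Suc n)) (g (Suc n))" for n
    using step[of n] by (simp add: f)
  define R where "R = \<lparr>res_basis = B, res_deg = dg, res_diff = (\<lambda>n. g (Suc n)), res_aug = (\<lambda>b. lookup (g 0 b) 0)\<rparr>"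
  have aug: "res_aug_map R x = lookup (linear_ext fvec_scale (g 0) x) 0" for x
    by (simp add: R_def lookup_linear_ext)
  have im0: "linear_ext fvec_scale (g 0) ` free_module (B 0) = single 0 ` J"
    by (rule minimal_coverD(3)[OF 0])
  have ker0: "res_aug_map R x = 0 \<longleftrightarrow> linear_ext fvec_scale (g 0) x = 0" if "x \<in> free_module (B 0)" for x
  proof -
    have "linear_ext fvec_scale (g 0) x \<in> single 0 ` J"
      unfolding im0[symmetric] using that by (rule imageI)
    then obtain p where "linear_ext fvec_scale (g 0) x = single 0 p" by (rule imageE)
    then show ?thesis by (metis aug lookup_single_eq single_zero)
  qed
  have "graded_free_resolution R J"
    unfolding graded_free_resolution_def
  proof (intro conjI allI ballI)
    fix i j show "finite {b \<in> res_basis R i. res_deg R i b = j}"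
      using good[of i] by (simp add: f R_def)
  next
    fix b assume "b \<in> res_basis R 0"
    then show "homogeneous (res_aug R b) (res_deg R 0 b)"
      using minimal_coverD(2)[OF 0] by (auto simp: R_def fvec_homogeneous_def homogeneous_def)
  next
    fix i b assume b: "b \<in> res_basis R (Suc i)"
    have "linear_ext fvec_scale (g (Suc i)) (unit_vec b) \<in> ?ker (B i) (g i)"
      unfolding minimal_coverD(3)[OF Suc, symmetric]
      using b by (intro imageI unit_vec_in_free_module) (simp add: R_def)
    then show "res_diff R i b \<in> res_module R i" by (simp add: R_def)
    show "fvec_homogeneous (res_deg R i) (res_diff R i b) (res_deg R (Suc i) b)"
      using minimal_coverD(2)[OF Suc[of i]] b by (simp add: R_def)
  next
    have "res_aug_map R ` res_module R 0 = (\<lambda>y. lookup y 0) ` (linear_ext fvec_scale (g 0) ` free_module (B 0))"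
      unfolding image_image aug by (simp add: R_def)
    then show "res_aug_map R ` res_module R 0 = J"
      unfolding im0 by (simp add: image_image)
  next
    have "{x \<in> res_module R 0. res_aug_map R x = 0} = ?ker (B 0) (g 0)"
      using ker0 by (auto simp: R_def)
    then show "{x \<in> res_module R 0. res_aug_map R x = 0} = res_map R 0 ` res_module R 1"
      using minimal_coverD(3)[OF Suc[of 0]] by (simp add: R_def)
  next
    fix i
    show "{x \<in> res_module R (Suc i). res_map R i x = 0} = res_map R (Suc i) ` res_module R (Suc (Suc i))"
      using minimal_coverD(3)[OF Suc[of "Suc i"]] by (simp add: R_def)
  qed
  moreover have "lookup (res_diff R i b) c \<in> irrelevant_ideal" if b: "b \<in> res_basis R (Suc i)" for i b c
  proof -
    have "linear_ext fvec_scale (g (Suc i)) (unit_vec b) \<in> ?ker (B i) (g i)"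
      unfolding minimal_coverD(3)[OF Suc, symmetric]
      using b by (intro imageI unit_vec_in_free_module) (simp add: R_def)
    moreover have "\<forall>x\<in>?ker (B i) (g i). lookup x c \<in> irrelevant_ideal"
      using minimal_coverD(4)[OF 0] minimal_coverD(4)[OF Suc[of "i - 1"]] by (cases i) auto
    ultimately show ?thesis by (simp add: R_def)
  qed
  ultimately show ?thesis
    by (auto simp: minimal_graded_free_resolution_def)
qed

section \<open>Monomial ideals\<close>

text \<open>
  The polynomials satisfying the right-hand side form an ideal that contains the generators, and
  each of their terms is a multiple of a generator.
\<close>

lemma mem_monomial_ideal_iff:
  "p \<in> ideal_gen (monom ` G) \<longleftrightarrow> (\<forall>a\<in>keys (p :: ('v, 'k::field) mpoly). \<exists>g\<in>G. g adds a)"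
proof
  have "ideal_gen (monom ` G) \<subseteq> {p :: ('v, 'k) mpoly. \<forall>a\<in>keys p. \<exists>g\<in>G. g adds a}"
    unfolding ideal_gen_def
  proof (rule ideal.span_minimal)
    show "ideal.subspace {p :: ('v, 'k) mpoly. \<forall>a\<in>keys p. \<exists>g\<in>G. g adds a}"
    proof (rule ideal.subspaceI)
      fix p q :: "('v, 'k) mpoly"
      assume *: "p \<in> {p. \<forall>a\<in>keys p. \<exists>g\<in>G. g adds a}"
      show "q \<in> {p. \<forall>a\<in>keys p. \<exists>g\<in>G. g adds a} \<Longrightarrow> p + q \<in> {p. \<forall>a\<in>keys p. \<exists>g\<in>G. g adds a}"
        using * Poly_Mapping.keys_add[of p q] by blast
      have "\<exists>g\<in>G. g adds a + h" if h: "h \<in> keys p" for a h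
      proof -
        from * h obtain g where "g \<in> G" "g adds h" by blast
        moreover have "h adds a + h" by (auto simp: adds_def add.commute)
        ultimately show ?thesis using adds_trans by blast
      qed
      then show "q * p \<in> {p. \<forall>a\<in>keys p. \<exists>g\<in>G. g adds a}"
        using keys_mult[of q p] by blast
    qed simp
    show "monom ` G \<subseteq> {p :: ('v, 'k) mpoly. \<forall>a\<in>keys p. \<exists>g\<in>G. g adds a}"
      using adds_refl by (fastforce simp: monom_def)
  qed
  then show "p \<in> ideal_gen (monom ` G) \<Longrightarrow> \<forall>a\<in>keys p. \<exists>g\<in>G. g adds a" by blast
next
  assume *: "\<forall>a\<in>keys p. \<exists>g\<in>G. g adds a"
  have "(\<Sum>a\<in>keys p. single a (lookup p a)) \<in> ideal_gen (monom ` G)"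
    unfolding ideal_gen_def
  proof (rule ideal.span_sum)
    fix a assume "a \<in> keys p"
    with * obtain g c where "g \<in> G" "a = g + c" by (auto simp: adds_def)
    then have "single a (lookup p a) = single c (lookup p a) * monom g" "monom g \<in> monom ` G"
      by (auto simp: monom_def mult_single add.commute)
    then show "single a (lookup p a) \<in> ideal.span (monom ` G)"
      using ideal.span_base ideal.span_scale by metis
  qed
  then show "p \<in> ideal_gen (monom ` G)" by (simp flip: poly_mapping_eq_sum_single)
qed

lemma monom_mem_monomial_ideal: "g \<in> G \<Longrightarrow> monom g \<in> ideal_gen (monom ` G)"
  by (simp add: ideal_gen_def ideal.span_base)

lemma graded_submodule_monomial_ideal:
  fixes G :: "'v::finite expo set"
  shows "graded_submodule (\<lambda>_. 0) (single (0::nat) ` (ideal_gen (monom ` G) :: ('v, 'k::field) mpoly set))"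
    (is "graded_submodule _ (single 0 ` ?J)")
  unfolding graded_submodule_def
proof (intro conjI ballI allI)
  have sub: "ideal.subspace ?J" by (simp add: ideal_gen_def)
  show "fvec.subspace (single (0::nat) ` ?J)"
  proof (rule fvec.subspaceI)
    show "0 \<in> single (0::nat) ` ?J"
      using ideal.subspace_0[OF sub] by (metis image_eqI single_zero)
  next
    fix x y assume "x \<in> single (0::nat) ` ?J" "y \<in> single (0::nat) ` ?J"
    then show "x + y \<in> single (0::nat) ` ?J"
      using ideal.subspace_add[OF sub] by (auto simp flip: single_add)
  next
    fix s x assume "x \<in> single (0::nat) ` ?J"
    then obtain p where p: "p \<in> ?J" "x = single 0 p" by blast
    have "fvec_scale s x = single 0 (s * p)"
      unfolding p by (rule poly_mapping_eqI) (simp add: lookup_single when_def)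
    then show "fvec_scale s x \<in> single (0::nat) ` ?J"
      using ideal.subspace_scale[OF sub p(1)] by blast
  qed
next
  fix x d assume "x \<in> single (0::nat) ` ?J"
  then obtain p where p: "p \<in> ?J" "x = single 0 p" by blast
  have "hom_part (\<lambda>_. 0) d x = single 0 (restrict_poly {a. expo_deg a = d} p)"
    unfolding p by (intro poly_mapping_eqI) (simp add: lookup_single when_def)
  moreover have "restrict_poly {a. expo_deg a = d} p \<in> ?J"
    using p(1) unfolding mem_monomial_ideal_iff by (auto simp: in_keys_iff)
  ultimately show "hom_part (\<lambda>_. 0) d x \<in> single (0::nat) ` ?J" by blast
qed

section \<open>Linear relations of monomial ideals\<close>

text \<open>
  Two generators of degree \<open>e\<close> are joined below \<open>L\<close> if they have a common multiple of degree
  \<open>e + 1\<close> that divides \<open>L\<close>, that is, if they are equal up to exchanging one variable and the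
  resulting linear relation lives in a multidegree dividing \<open>L\<close>.
\<close>

definition linear_step :: "'v::finite expo set \<Rightarrow> nat \<Rightarrow> 'v expo \<Rightarrow> ('v expo \<times> 'v expo) set" where
  "linear_step G e L = {(g, h). g \<in> G \<and> h \<in> G \<and>
     (\<exists>m. expo_deg m = e + 1 \<and> g adds m \<and> h adds m \<and> m adds L)}"

text \<open>
  The graded Betti numbers are read off a resolution about which nothing is known beyond
  minimality, so the comparison has to work for an arbitrary one. The first
  syzygies of the resolution are compared with the relations between the monomial generators by
  lifting these generators along the augmentation.
\<close>

locale monomial_ideal_resolution =
  fixes G :: "'v::finite expo set" and e :: nat and R :: "('v, 'k::field) free_res"
  assumes deg_G: "\<And>g. g \<in> G \<Longrightarrow> expo_deg g = e"
    and resolution: "minimal_graded_free_resolution R (ideal_gen (monom ` G))"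
begin

abbreviation "J \<equiv> (ideal_gen (monom ` G) :: ('v, 'k) mpoly set)"
abbreviation "F0 \<equiv> res_module R 0"
abbreviation "F1 \<equiv> res_module R 1"
abbreviation "aug \<equiv> res_aug R"
abbreviation "aug_map \<equiv> res_aug_map R"
abbreviation "d0 \<equiv> res_map R 0"

lemma graded_resolution: "graded_free_resolution R J"
  using resolution by (simp add: minimal_graded_free_resolution_def)

lemma finite_degree: "finite {b \<in> res_basis R i. res_deg R i b = j}"
  using graded_resolution by (simp add: graded_free_resolution_def)

lemma aug_homogeneous: "b \<in> res_basis R 0 \<Longrightarrow> homogeneous (aug b) (res_deg R 0 b)"
  using graded_resolution by (simp add: graded_free_resolution_def)

lemma image_aug_map: "aug_map ` F0 = J"
  using graded_resolution by (simp add: graded_free_resolution_def)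

lemma kernel_aug_map: "{x \<in> F0. aug_map x = 0} = d0 ` F1"
  using graded_resolution by (simp add: graded_free_resolution_def)

lemma diff_in: "b \<in> res_basis R 1 \<Longrightarrow> res_diff R 0 b \<in> F0"
  using graded_resolution by (simp add: graded_free_resolution_def)

lemma diff_homogeneous:
  "b \<in> res_basis R 1 \<Longrightarrow> fvec_homogeneous (res_deg R 0) (res_diff R 0 b) (res_deg R 1 b)"
  using graded_resolution by (simp add: graded_free_resolution_def)

lemma diff_minimal: "b \<in> res_basis R (Suc i) \<Longrightarrow> lookup (lookup (res_diff R i b) c) 0 = 0"
  using resolution by (simp add: minimal_graded_free_resolution_def irrelevant_ideal_iff)

lemma aug_mem: "b \<in> res_basis R 0 \<Longrightarrow> aug b \<in> J"
  using image_aug_map unit_vec_in_free_module[of b "res_basis R 0"] linear_ext_unit_vec(2) by (metis imageI)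

text \<open>
  The kernel consists of the combinations of the next differentials, which are minimal. This is
  the sense in which no generator of the first syzygies is redundant.
\<close>

lemma kernel_d0_minimal:
  assumes "x \<in> F1" "d0 x = 0"
  shows "lookup (lookup x b) 0 = 0"
proof -
  have "{x \<in> res_module R (Suc 0). d0 x = 0} = res_map R (Suc 0) ` res_module R (Suc (Suc 0))"
    using graded_resolution by (simp add: graded_free_resolution_def)
  then obtain y where y: "y \<in> res_module R 2" "x = res_map R 1 y"
    using assms by (auto simp: numeral_2_eq_2)
  have "x \<in> {x. \<forall>b. lookup (lookup x b) 0 = 0}"
    unfolding y(2)
  proof (rule linear_ext_mem[OF _ _ y(1)])
    show "fvec.subspace {x :: ('v, 'k) fvec. \<forall>b. lookup (lookup x b) 0 = 0}"
      by (rule fvec.subspaceI) (auto simp: lookup_add lookup_times_0)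
  qed (use diff_minimal[of _ 1] in \<open>auto simp: numeral_2_eq_2\<close>)
  then show ?thesis by simp
qed

text \<open>
  This is the compatibility with the grading for the map into the ring, obtained from the one for
  free modules by viewing the ring as a free module of rank one.
\<close>

lemma aug_map_hom_part:
  assumes "x \<in> F0"
  shows "aug_map (hom_part (res_deg R 0) d x) = restrict_poly {a. expo_deg a = d} (aug_map x)"
proof -
  let ?g = "\<lambda>b. single (0::nat) (aug b)"
  have eq: "aug_map y = lookup (linear_ext fvec_scale ?g y) 0" for y
    by (simp add: lookup_linear_ext)
  have hom: "fvec_homogeneous (\<lambda>_. 0) (?g b) (res_deg R 0 b)" if "b \<in> res_basis R 0" for b
    using aug_homogeneous[OF that]
    by (auto simp: fvec_homogeneous_def homogeneous_def lookup_single when_def split: if_splits)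
  have "hom_part (\<lambda>_. 0) d (linear_ext fvec_scale ?g x) = linear_ext fvec_scale ?g (hom_part (res_deg R 0) d x)"
    by (rule hom_part_linear_ext[of "res_basis R 0" "\<lambda>_. 0" ?g "res_deg R 0" x d, OF hom assms])
  from arg_cong[OF this, of "\<lambda>z. lookup z 0"] show ?thesis by (simp add: eq)
qed

lemma homogeneous_lift:
  assumes "g \<in> G"
  obtains y where "y \<in> F0" "fvec_homogeneous (res_deg R 0) y e" "aug_map y = monom g"
proof -
  obtain x where x: "x \<in> F0" "aug_map x = monom g"
    using monom_mem_monomial_ideal[OF assms] image_aug_map by (metis imageE)
  show thesis
  proof (rule that)
    show "hom_part (res_deg R 0) e x \<in> F0" by (rule hom_part_in_free_module[OF x(1)])
    show "fvec_homogeneous (res_deg R 0) (hom_part (res_deg R 0) e x) e" by (rule hom_part_homogeneous)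
    show "aug_map (hom_part (res_deg R 0) e x) = monom g"
      unfolding aug_map_hom_part[OF x(1)] x(2)
      by (rule poly_mapping_eqI) (use deg_G[OF assms] in \<open>auto simp: monom_def lookup_single when_def\<close>)
  qed
qed

lemma diff_mem_kernel: "b \<in> res_basis R 1 \<Longrightarrow> aug_map (res_diff R 0 b) = 0"
  using kernel_aug_map unit_vec_in_free_module[of b "res_basis R 1"] linear_ext_unit_vec(1)[of "res_diff R 0" b]
  by (metis (mono_tags, lifting) imageI mem_Collect_eq)

text \<open>
  Suppose that a basis element \<open>b0\<close> of the first syzygy module has a degree other than \<open>e + 1\<close>.
  Let \<open>M\<close> be the set of all syzygies that can be written without using \<open>b0\<close> with a nonzero constant
  coefficient. It contains every syzygy of degree \<open>e + 1\<close>, for degree reasons, and every product of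
  a syzygy with an element of the irrelevant ideal. The goal is that it also contains the image of
  \<open>b0\<close>: this contradicts minimality.

  Lift each generator \<open>x\<^sup>g\<close> to a homogeneous element \<open>y g\<close>. If generators \<open>g\<close> and \<open>h\<close> are joined
  below \<open>L\<close>, then the multiples of \<open>y g\<close> and \<open>y h\<close> in multidegree \<open>L\<close> agree modulo \<open>M\<close>; by
  connectedness this holds for all generators dividing \<open>x\<^sup>L\<close>. Choosing one such multiple \<open>\<theta> L\<close>
  for each \<open>L\<close> gives an additive section \<open>\<Theta>\<close> of the augmentation on the ideal which is linear
  modulo \<open>M\<close>. Therefore each \<open>x\<close> with coefficients in the irrelevant ideal is congruent to
  \<open>\<Theta>\<close> of its image, and a syzygy of this kind lies in \<open>M\<close>.
\<close>

lemma linear_relations_if_connected: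
  assumes conn: "\<And>L g h. g \<in> G \<Longrightarrow> h \<in> G \<Longrightarrow> g adds L \<Longrightarrow> h adds L \<Longrightarrow> (g, h) \<in> (linear_step G e L)\<^sup>*"
    and b0: "b0 \<in> res_basis R 1"
  shows "res_deg R 1 b0 = e + 1"
proof (rule ccontr)
  assume deg_b0: "res_deg R 1 b0 \<noteq> e + 1"
  define T where "T = {t \<in> F1. lookup (lookup t b0) 0 = 0}"
  have subT: "fvec.subspace T"
    unfolding T_def
    using fvec.subspace_0[OF subspace_free_module] fvec.subspace_add[OF subspace_free_module]
      fvec.subspace_scale[OF subspace_free_module]
    by (intro fvec.subspaceI) (auto simp: lookup_add lookup_times_0)
  define M where "M = d0 ` T"
  have subM: "fvec.subspace M" unfolding M_def by (rule fhom.subspace_image[OF subT])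
  note M_add = fvec.subspace_add[OF subM] and M_scale = fvec.subspace_scale[OF subM]
  have M_max: "fvec_scale p r \<in> M" if r: "r \<in> F0" "aug_map r = 0" and p: "lookup p 0 = 0" for p r
  proof -
    obtain t where t: "t \<in> F1" "r = d0 t" using r kernel_aug_map by blast
    have "fvec_scale p t \<in> T"
      using fvec.subspace_scale[OF subspace_free_module t(1)] p by (auto simp: T_def lookup_times_0)
    then show ?thesis unfolding M_def t(2) by (metis fhom.scale imageI)
  qed
  have M_linear: "r \<in> M" if r: "r \<in> F0" "aug_map r = 0" and hom: "fvec_homogeneous (res_deg R 0) r (e + 1)" for r
  proof -
    obtain t where t: "t \<in> F1" "r = d0 t" using r kernel_aug_map by blast
    have "d0 (hom_part (res_deg R 1) (e + 1) t) = hom_part (res_deg R 0) (e + 1) r"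
      unfolding t(2)
      by (rule hom_part_linear_ext[of "res_basis R 1", OF diff_homogeneous t(1), symmetric])
    also have "\<dots> = r" by (rule hom_part_eq_self[OF hom])
    finally have "r = d0 (hom_part (res_deg R 1) (e + 1) t)" ..
    moreover have "hom_part (res_deg R 1) (e + 1) t \<in> T"
      using hom_part_in_free_module[OF t(1)] deg_b0 by (simp add: T_def)
    ultimately show ?thesis unfolding M_def by blast
  qed
  have "\<forall>g\<in>G. \<exists>y. y \<in> F0 \<and> fvec_homogeneous (res_deg R 0) y e \<and> aug_map y = monom g"
    using homogeneous_lift by metis
  then obtain y where "\<forall>g\<in>G. y g \<in> F0 \<and> fvec_homogeneous (res_deg R 0) (y g) e \<and> aug_map (y g) = monom g"
    by (rule bchoice[THEN exE])
  then have y: "\<And>g. g \<in> G \<Longrightarrow> y g \<in> F0"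
      "\<And>g. g \<in> G \<Longrightarrow> fvec_homogeneous (res_deg R 0) (y g) e" "\<And>g. g \<in> G \<Longrightarrow> aug_map (y g) = monom g"
    by simp_all
  \<comment> \<open>The relation between two joined generators is a multiple of one of degree \<open>e + 1\<close>.\<close>
  have step_mem: "fvec_scale (monom (L - g)) (y g) - fvec_scale (monom (L - h)) (y h) \<in> M"
    if gh: "(g, h) \<in> linear_step G e L" for g h L
  proof -
    from gh obtain m p q s where G: "g \<in> G" "h \<in> G" and m: "expo_deg m = e + 1" "m = g + p" "m = h + q" "L = m + s"
      unfolding linear_step_def adds_def by blast
    let ?r = "fvec_scale (monom p) (y g) - fvec_scale (monom q) (y h)"
    have "L = g + (s + p)" "L = h + (s + q)"
      subgoal unfolding m(4) m(2) by (simp add: ac_simps)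
      subgoal unfolding m(4) m(3) by (simp add: ac_simps)
      done
    then have "L - g = s + p" "L - h = s + q"
      by (metis add_diff_cancel_left')+
    then have "fvec_scale (monom (L - g)) (y g) - fvec_scale (monom (L - h)) (y h) = fvec_scale (monom s) ?r"
      by (simp add: fvec.scale_right_diff_distrib monom_def mult_single)
    moreover have "?r \<in> M"
    proof (rule M_linear)
      show "?r \<in> F0"
        by (intro fvec.subspace_diff[OF subspace_free_module] fvec.subspace_scale[OF subspace_free_module] y G)
      show "aug_map ?r = 0"
        using m G by (simp add: phom.diff phom.scale y monom_def mult_single add.commute)
      have pq: "expo_deg p = 1" "expo_deg q = 1"
        using m(1) deg_G[OF G(1)] deg_G[OF G(2)] expo_deg_add[of g p] expo_deg_add[of h q]
        by (simp_all flip: m(2,3))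
      have "fvec_homogeneous (res_deg R 0) (fvec_scale (monom p) (y g)) (1 + e)"
        "fvec_homogeneous (res_deg R 0) (fvec_scale (- monom q) (y h)) (1 + e)"
        using homogeneous_single[of p 1] homogeneous_single[of q "- 1"] unfolding pq monom_def single_uminus
        by (blast intro: fvec_homogeneous_scale y G)+
      from fvec_homogeneous_add[OF this]
      show "fvec_homogeneous (res_deg R 0) ?r (e + 1)" by simp
    qed
    ultimately show ?thesis by (simp add: M_scale)
  qed
  have path: "fvec_scale (monom (L - g)) (y g) - fvec_scale (monom (L - h)) (y h) \<in> M"
    if "(g, h) \<in> (linear_step G e L)\<^sup>*" for g h L
    using that
  proof (induction rule: rtrancl_induct)
    case base
    then show ?case using fvec.subspace_0[OF subM] by simp
  next
    case (step h k)
    from M_add[OF step(3) step_mem[OF step(2)]] show ?case by simp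
  qed
  \<comment> \<open>These are the choices of a generator and of a lift for the exponents of monomials in the ideal.\<close>
  define c where "c a = (SOME g. g \<in> G \<and> g adds a)" for a
  have c: "c a \<in> G" "c a adds a" if "g \<in> G" "g adds a" for g a
    unfolding c_def using someI[of "\<lambda>g. g \<in> G \<and> g adds a" g] that by auto
  define \<theta> where "\<theta> a = fvec_scale (monom (a - c a)) (y (c a))" for a
  define \<Theta> where "\<Theta> p = (\<Sum>a\<in>keys p. fvec_scale (single 0 (lookup p a)) (\<theta> a))" for p :: "('v, 'k) mpoly"
  interpret Theta: additive \<Theta>
  proof
    show "\<Theta> (p + q) = \<Theta> p + \<Theta> q" for p q
      unfolding \<Theta>_def by (rule setsum_keys_plus_distrib) (simp_all add: single_add fvec.scale_left_distrib)
  qed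
  have Theta_single: "\<Theta> (single a k) = fvec_scale (single 0 k) (\<theta> a)" for a k
    by (simp add: \<Theta>_def)
  \<comment> \<open>The elements with this property form an ideal, so it suffices to treat the monomial generators.\<close>
  have lift: "\<exists>x. x \<in> F0 \<and> aug_map x = p \<and> (\<forall>s. fvec_scale s x - \<Theta> (s * p) \<in> M)" if "p \<in> J" for p
  proof -
    let ?P = "{p. \<exists>x. x \<in> F0 \<and> aug_map x = p \<and> (\<forall>s. fvec_scale s x - \<Theta> (s * p) \<in> M)}"
    have "J \<subseteq> ?P"
      unfolding ideal_gen_def
    proof (rule ideal.span_minimal)
      show "ideal.subspace ?P"
      proof (rule ideal.subspaceI)
        show "0 \<in> ?P"
          using fvec.subspace_0[OF subspace_free_module] fvec.subspace_0[OF subM]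
          by (auto intro!: exI[of _ 0] simp: Theta.zero)
      next
        fix p q assume "p \<in> ?P" "q \<in> ?P"
        then obtain x z where xz: "x \<in> F0" "aug_map x = p" "\<And>s. fvec_scale s x - \<Theta> (s * p) \<in> M"
          "z \<in> F0" "aug_map z = q" "\<And>s. fvec_scale s z - \<Theta> (s * q) \<in> M" by blast
        have "fvec_scale s (x + z) - \<Theta> (s * (p + q)) \<in> M" for s
          using M_add[OF xz(3)[of s] xz(6)[of s]]
          by (simp only: fvec.scale_right_distrib distrib_left Theta.add add_diff_add)
        moreover have "x + z \<in> F0" by (rule fvec.subspace_add[OF subspace_free_module xz(1,4)])
        moreover have "aug_map (x + z) = p + q" by (simp add: phom.add xz)
        ultimately show "p + q \<in> ?P" by blast
      next
        fix t p assume "p \<in> ?P"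
        then obtain x where x: "x \<in> F0" "aug_map x = p" "\<And>s. fvec_scale s x - \<Theta> (s * p) \<in> M" by blast
        have "fvec_scale s (fvec_scale t x) - \<Theta> (s * (t * p)) \<in> M" for s
          using x(3)[of "s * t"] by (simp add: mult.assoc)
        moreover have "fvec_scale t x \<in> F0" by (rule fvec.subspace_scale[OF subspace_free_module x(1)])
        moreover have "aug_map (fvec_scale t x) = t * p" by (simp add: phom.scale x)
        ultimately show "t * p \<in> ?P" by blast
      qed
      show "monom ` G \<subseteq> ?P"
      proof
        fix p :: "('v, 'k) mpoly" assume "p \<in> monom ` G"
        then obtain g where g: "g \<in> G" "p = monom g" by blast
        have "fvec_scale s (y g) - \<Theta> (s * p) \<in> M" for s
        proof -
          have "fvec_scale s (y g) - \<Theta> (s * p) = fvec_scale (\<Sum>a\<in>keys s. single a (lookup s a)) (y g)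
              - \<Theta> ((\<Sum>a\<in>keys s. single a (lookup s a)) * p)"
            by (simp flip: poly_mapping_eq_sum_single)
          also have "\<dots> = (\<Sum>a\<in>keys s. fvec_scale (single a (lookup s a)) (y g) - \<Theta> (single a (lookup s a) * p))"
            by (simp add: fvec.scale_sum_left sum_distrib_right Theta.sum sum_subtractf)
          also have "\<dots> \<in> M"
          proof (rule fvec.subspace_sum[OF subM])
            fix a
            let ?k = "lookup s a" and ?L = "a + g"
            have gL: "g adds ?L" by (auto simp: adds_def add.commute)
            have "fvec_scale (monom (?L - g)) (y g) - \<theta> ?L \<in> M"
              unfolding \<theta>_def by (intro path conn g(1) c[OF g(1)] gL)
            from M_scale[OF this, of "single 0 ?k"]
            show "fvec_scale (single a ?k) (y g) - \<Theta> (single a ?k * p) \<in> M"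
              by (simp add: g(2) monom_def mult_single Theta_single fvec.scale_right_diff_distrib)
          qed
          finally show ?thesis .
        qed
        then show "p \<in> ?P" using y g by blast
      qed
    qed
    with that show ?thesis by blast
  qed
  have generic: "x - \<Theta> (aug_map x) \<in> M" if x: "x \<in> F0" and x0: "\<And>b. lookup (lookup x b) 0 = 0" for x
  proof -
    have "x - \<Theta> (aug_map x) = linear_ext fvec_scale unit_vec x - \<Theta> (linear_ext (*) aug x)"
      by (simp add: linear_ext_unit_vecs)
    also have "\<dots> = (\<Sum>b\<in>keys x. fvec_scale (lookup x b) (unit_vec b) - \<Theta> (lookup x b * aug b))"
      by (simp add: linear_ext_def Theta.sum sum_subtractf)
    also have "\<dots> \<in> M"
    proof (rule fvec.subspace_sum[OF subM])
      fix b assume "b \<in> keys x"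
      with x have b: "b \<in> res_basis R 0" by (auto simp: free_module_def)
      obtain z where z: "z \<in> F0" "aug_map z = aug b" "\<And>s. fvec_scale s z - \<Theta> (s * aug b) \<in> M"
        using lift[OF aug_mem[OF b]] by blast
      \<comment> \<open>\<open>unit_vec b - z\<close> is a syzygy, and the coefficient of \<open>x\<close> lies in the irrelevant ideal.\<close>
      have "fvec_scale (lookup x b) (unit_vec b - z) \<in> M"
        using unit_vec_in_free_module[OF b] z fvec.subspace_diff[OF subspace_free_module]
        by (intro M_max x0) (auto simp: phom.diff)
      from M_add[OF this z(3)[of "lookup x b"]]
      show "fvec_scale (lookup x b) (unit_vec b) - \<Theta> (lookup x b * aug b) \<in> M"
        by (simp add: fvec.scale_right_diff_distrib)
    qed
    finally show ?thesis .
  qed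
  have "d0 (unit_vec b0) \<in> M"
    using generic[OF diff_in[OF b0]] diff_minimal[of b0 0] b0 by (simp add: diff_mem_kernel Theta.zero)
  then obtain t where t: "t \<in> T" "d0 (unit_vec b0) = d0 t" unfolding M_def by blast
  have "unit_vec b0 - t \<in> F1"
    using t(1) unit_vec_in_free_module[OF b0] fvec.subspace_diff[OF subspace_free_module] by (auto simp: T_def)
  moreover have "d0 (unit_vec b0 - t) = 0" using t(2) by (simp only: fhom.diff diff_self)
  ultimately have "lookup (lookup (unit_vec b0 - t) b0) 0 = 0" by (rule kernel_d0_minimal)
  then show False using t(1) by (simp add: T_def lookup_minus)
qed

text \<open>
  Let \<open>C\<close> be the connected component of \<open>u\<close> below \<open>L\<close>. Truncating the images of the basis elements
  to the exponents in \<open>C\<close> changes the augmentation into a linear map \<open>N\<close>. All generators dividing a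
  fixed monomial of degree \<open>e + 1\<close> that divides \<open>x\<^sup>L\<close> are joined to each other, so either all or none
  of them are in \<open>C\<close>, and the corresponding coefficient of \<open>N\<close> on a linear syzygy is that of the
  augmentation or trivially zero. Hence \<open>N\<close> maps the syzygies into the ideal \<open>Z\<close> of polynomials
  without terms dividing \<open>x\<^sup>L\<close>. The relation between \<open>x\<^sup>u\<close> and \<open>x\<^sup>v\<close> in multidegree \<open>L\<close> is
  mapped to a polynomial whose coefficient at \<open>L\<close> is \<open>1\<close> unless \<open>v\<close> belongs to \<open>C\<close> too.
\<close>

lemma connected_if_linear_relations:
  assumes linear: "\<And>b. b \<in> res_basis R 1 \<Longrightarrow> res_deg R 1 b = e + 1"
    and u: "u \<in> G" "u adds L" and v: "v \<in> G" "v adds L"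
  shows "(u, v) \<in> (linear_step G e L)\<^sup>*"
proof -
  define C where "C = {g \<in> G. (u, g) \<in> (linear_step G e L)\<^sup>*}"
  define N where "N = linear_ext (*) (\<lambda>b. restrict_poly C (aug b))"
  define Z where "Z = {p :: ('v, 'k) mpoly. \<forall>m. m adds L \<longrightarrow> lookup p m = 0}"
  have subZ: "ideal.subspace Z"
    unfolding Z_def
  proof (rule ideal.subspaceI, goal_cases)
    case (3 s p)
    have "lookup (s * p) m = 0" if "m adds L" for m
    proof (rule lookup_times_eq_0)
      fix a h assume "m = a + h" "h \<in> keys p"
      moreover from this have "h adds m" by (auto simp: adds_def add.commute)
      ultimately show False using 3 that adds_trans by (auto simp: in_keys_iff)
    qed
    then show ?case by simp
  qed (auto simp: lookup_add)
  have C_G: "C \<subseteq> G" by (auto simp: C_def)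
  have keys_aug: "expo_deg a = res_deg R 0 b \<and> (\<exists>g\<in>G. g adds a)"
    if "b \<in> res_basis R 0" "a \<in> keys (aug b)" for a b
    using that aug_homogeneous aug_mem[unfolded mem_monomial_ideal_iff] by (auto simp: homogeneous_def)
  have eq_if_adds: "k = h" if "g \<in> G" "g adds k" "k adds h" "expo_deg h \<le> e" for g k h
    using that deg_G adds_deg_le adds_same_deg by (metis le_trans)
  have N_sum: "N x = (\<Sum>b\<in>keys x. lookup x b * restrict_poly C (aug b))" for x
    by (simp add: N_def linear_ext_def)
  have aug_sum: "aug_map x = (\<Sum>b\<in>keys x. lookup x b * aug b)" for x
    by (simp add: linear_ext_def)
  have basis: "b \<in> res_basis R 0" if "x \<in> F0" "b \<in> keys x" for x b
    using that by (auto simp: free_module_def)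
  \<comment> \<open>All exponents in the ideal have degree at least \<open>e\<close>, so a coefficient at a generator comes from
    constant coefficients and the coefficients of the basis images at that same generator.\<close>
  have N_C: "lookup (N x) h = lookup (aug_map x) h" if h: "h \<in> C" and x: "x \<in> F0" for h x
  proof -
    have "lookup (lookup x b * (restrict_poly C (aug b) - aug b)) h = 0" if b: "b \<in> keys x" for b
    proof (rule lookup_times_eq_0)
      fix a k assume k: "h = a + k" "k \<in> keys (restrict_poly C (aug b) - aug b)"
      then have "k \<in> keys (aug b)" "k \<notin> C" by (auto simp: in_keys_iff lookup_minus when_def split: if_splits)
      moreover have "k adds h" using k by (auto simp: adds_def add.commute)
      ultimately show False
        using keys_aug[OF basis[OF x b]] eq_if_adds deg_G h C_G by (metis order_refl subsetD)
    qed
    then show ?thesis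
      unfolding N_sum aug_sum lookup_sum
      by (intro sum.cong) (simp_all add: right_diff_distrib lookup_minus)
  qed
  have N_not_C: "lookup (N x) h = 0" if h: "h \<in> G" "h \<notin> C" for h x
    unfolding N_sum lookup_sum
  proof (intro sum.neutral ballI lookup_times_eq_0)
    fix b a k assume k: "h = a + k" "k \<in> keys (restrict_poly C (aug b))"
    then have "k \<in> C" by (auto simp: in_keys_iff)
    moreover have "k adds h" using k by (auto simp: adds_def add.commute)
    ultimately show False using eq_if_adds[of k k h] h C_G deg_G by auto
  qed
  have N_diff: "N (res_diff R 0 c) \<in> Z" if c: "c \<in> res_basis R 1" for c
    unfolding Z_def
  proof (intro CollectI allI impI)
    fix m assume m: "m adds L"
    let ?w = "res_diff R 0 c"
    have w: "?w \<in> F0" by (rule diff_in[OF c])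
    have deg_w: "expo_deg a + res_deg R 0 b = e + 1" if "a \<in> keys (lookup ?w b)" for a b
      using diff_homogeneous[OF c] that unfolding fvec_homogeneous_def linear[OF c] by blast
    show "lookup (N ?w) m = 0"
    proof (cases "expo_deg m = e + 1 \<and> (\<exists>g\<in>C. g adds m)")
      case True
      then obtain g where g: "g \<in> C" "g adds m" and dm: "expo_deg m = e + 1" by blast
      have "lookup (lookup ?w b * (restrict_poly C (aug b) - aug b)) m = 0" if b: "b \<in> keys ?w" for b
      proof (rule lookup_times_eq_0)
        fix a h assume a: "m = a + h" "a \<in> keys (lookup ?w b)" and "h \<in> keys (restrict_poly C (aug b) - aug b)"
        then have h: "h \<in> keys (aug b)" "h \<notin> C" by (auto simp: in_keys_iff lookup_minus when_def split: if_splits)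
        have "a \<noteq> 0" using a(2) diff_minimal[of c 0 b] c by (auto simp: in_keys_iff)
        then have "expo_deg a > 0" by (metis expo_deg_eq_0_iff neq0_conv)
        then have "expo_deg h \<le> e" using dm expo_deg_add[of a h] unfolding a(1) by linarith
        then have "h \<in> G" using keys_aug[OF basis[OF w b] h(1)] eq_if_adds by (metis adds_refl deg_G adds_same_deg)
        moreover have "h adds m" using a(1) by (auto simp: adds_def add.commute)
        ultimately have "(g, h) \<in> linear_step G e L" using g C_G dm m by (auto simp: linear_step_def)
        then have "h \<in> C" using g \<open>h \<in> G\<close> by (auto simp: C_def intro: rtrancl_into_rtrancl)
        then show False using h by blast
      qed
      then have "lookup (N ?w) m = lookup (aug_map ?w) m"
        unfolding N_sum aug_sum lookup_sum
        by (intro sum.cong) (simp_all add: right_diff_distrib lookup_minus)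
      then show ?thesis by (simp add: diff_mem_kernel[OF c])
    next
      case False
      show ?thesis
        unfolding N_sum lookup_sum
      proof (intro sum.neutral ballI lookup_times_eq_0)
        fix b a k assume b: "b \<in> keys ?w" and k: "m = a + k" "a \<in> keys (lookup ?w b)" "k \<in> keys (restrict_poly C (aug b))"
        then have "k \<in> C" "k \<in> keys (aug b)" by (auto simp: in_keys_iff)
        moreover have "k adds m" using k by (auto simp: adds_def add.commute)
        moreover have "expo_deg m = e + 1"
          using deg_w[OF k(2)] keys_aug[OF basis[OF w b] \<open>k \<in> keys (aug b)\<close>] k(1) by (simp add: expo_deg_add)
        ultimately show False using False by blast
      qed
    qed
  qed
  interpret N: module_hom fvec_scale "(*)" N
    unfolding N_def by (rule phom.module_hom_axioms)
  have N_kernel: "N z \<in> Z" if "z \<in> F0" "aug_map z = 0" for z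
  proof -
    have "z \<in> d0 ` F1" unfolding kernel_aug_map[symmetric] using that by simp
    then obtain t where t: "z = d0 t" "t \<in> F1" by (rule imageE)
    have "fvec.subspace {z. N z \<in> Z}" by (rule N.subspace_linear_preimage[OF subZ])
    then have "d0 t \<in> {z. N z \<in> Z}"
      by (rule linear_ext_mem[OF _ _ t(2)]) (simp add: N_diff)
    then show ?thesis using t by simp
  qed
  obtain y z where y: "y \<in> F0" "aug_map y = monom u" and z: "z \<in> F0" "aug_map z = monom v"
    using homogeneous_lift u(1) v(1) by metis
  obtain p q where p: "L = p + u" and q: "L = q + v"
    using u(2) v(2) unfolding adds_def by (metis add.commute)
  have "u \<in> C" using u by (simp add: C_def)
  let ?x = "fvec_scale (monom p) y - fvec_scale (monom q) z"
  have "?x \<in> F0"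
    by (intro fvec.subspace_diff[OF subspace_free_module] fvec.subspace_scale[OF subspace_free_module] y z)
  moreover have "aug_map ?x = 0"
    using p q by (simp add: phom.diff phom.scale y z monom_def mult_single)
  ultimately have "lookup (N ?x) L = 0" using N_kernel by (auto simp: Z_def)
  moreover have "lookup (N ?x) L = lookup (N y) u - lookup (N z) v"
    using lookup_single_times[of p 1 "N y" u] lookup_single_times[of q 1 "N z" v] p q
    by (simp add: N.diff N.scale lookup_minus monom_def)
  moreover have "lookup (N y) u = 1"
    using N_C[OF \<open>u \<in> C\<close> y(1)] y(2) by (simp add: monom_def)
  ultimately have "v \<in> C" using N_not_C[OF v(1), of z] by auto
  then show ?thesis by (simp add: C_def)
qed

end

lemma monomial_ideal_resolution_some:
  assumes "\<And>g. g \<in> G \<Longrightarrow> expo_deg g = e"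
  shows "monomial_ideal_resolution G e (SOME R. minimal_graded_free_resolution R (ideal_gen (monom ` G) :: ('v::finite, 'k::field) mpoly set))"
  using assms someI_ex[OF ex_minimal_graded_free_resolution[OF graded_submodule_monomial_ideal]]
  by unfold_locales auto

text \<open>
  All terms of elements of \<open>I\<close> have degree at least \<open>d\<close>, and \<open>I\<close> contains a nonzero form of degree
  \<open>e\<close>.
\<close>

lemma generated_in_degree_le:
  fixes I :: "('v::finite, 'k::field) mpoly set"
  assumes "generated_in_degree I d" "generated_in_degree I e" "I \<noteq> {0}"
  shows "d \<le> e"
proof -
  obtain P Q where P: "\<forall>p\<in>P. homogeneous p d" "I = ideal_gen P" and Q: "\<forall>p\<in>Q. homogeneous p e" "I = ideal_gen Q"
    using assms(1,2) unfolding generated_in_degree_def by blast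
  have "I \<subseteq> {p. \<forall>a\<in>keys p. d \<le> expo_deg a}"
    unfolding P(2) ideal_gen_def
  proof (rule ideal.span_minimal)
    show "P \<subseteq> {p. \<forall>a\<in>keys p. d \<le> expo_deg a}" using P(1) by (auto simp: homogeneous_def)
    show "ideal.subspace {p :: ('v, 'k) mpoly. \<forall>a\<in>keys p. d \<le> expo_deg a}"
    proof (rule ideal.subspaceI, goal_cases)
      case (2 p q) then show ?case using Poly_Mapping.keys_add[of p q] by blast
    next
      case (3 s p)
      then show ?case using keys_mult[of s p] by (fastforce simp: expo_deg_add)
    qed simp
  qed
  moreover have "\<not> Q \<subseteq> {0}"
  proof
    assume "Q \<subseteq> {0}"
    then have "ideal.span Q \<subseteq> {0}" by (intro ideal.span_minimal) auto
    then show False using assms(3) ideal.span_zero[of Q] by (auto simp: Q ideal_gen_def)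
  qed
  then obtain q where q: "q \<in> Q" "q \<noteq> 0" by auto
  then obtain a where "a \<in> keys q" by (metis keys_eq_empty ex_in_conv)
  moreover have "q \<in> I" using q by (simp add: Q(2) ideal_gen_def ideal.span_base)
  ultimately show ?thesis using Q(1) q by (fastforce simp: homogeneous_def)
qed

lemma generated_in_degree_monomial_ideal:
  assumes "\<And>g. g \<in> G \<Longrightarrow> expo_deg g = e"
  shows "generated_in_degree (ideal_gen (monom ` G)) e"
  unfolding generated_in_degree_def
  by (rule exI[of _ "monom ` G"]) (use assms in \<open>auto simp: homogeneous_def monom_def\<close>)

text \<open>
  This translation makes the property purely combinatorial and, in particular, independent of the
  field.
\<close>

lemma linearly_related_monomial_ideal_iff:
  fixes G :: "'v::finite expo set"
  assumes deg: "\<And>g. g \<in> G \<Longrightarrow> expo_deg g = e"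
  shows "linearly_related (ideal_gen (monom ` G) :: ('v, 'k::field) mpoly set) \<longleftrightarrow>
    (\<forall>L. \<forall>g\<in>G. \<forall>h\<in>G. g adds L \<and> h adds L \<longrightarrow> (g, h) \<in> (linear_step G e L)\<^sup>*)"
proof -
  let ?J = "ideal_gen (monom ` G) :: ('v, 'k) mpoly set"
  define R :: "('v, 'k) free_res" where "R = (SOME R. minimal_graded_free_resolution R ?J)"
  interpret monomial_ideal_resolution G e R
    unfolding R_def by (rule monomial_ideal_resolution_some[OF deg])
  have betti: "graded_betti 1 j ?J = 0 \<longleftrightarrow> {b \<in> res_basis R 1. res_deg R 1 b = j} = {}" for j
    using finite_degree[of 1 j] by (simp add: graded_betti_def Let_def flip: R_def)
  show ?thesis
  proof
    assume lin: "linearly_related ?J"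
    show "\<forall>L. \<forall>g\<in>G. \<forall>h\<in>G. g adds L \<and> h adds L \<longrightarrow> (g, h) \<in> (linear_step G e L)\<^sup>*"
    proof (intro allI ballI impI, elim conjE)
      fix L g h assume gh: "g \<in> G" "h \<in> G" "g adds L" "h adds L"
      have "(monom g :: ('v, 'k) mpoly) \<noteq> 0"
        by (metis monom_def lookup_single_eq lookup_zero zero_neq_one)
      then have nz: "?J \<noteq> {0}" using monom_mem_monomial_ideal[OF gh(1)] by blast
      with lin obtain e' where e': "generated_in_degree ?J e'" "\<forall>j. j \<noteq> e' + 1 \<longrightarrow> graded_betti 1 j ?J = 0"
        by (auto simp: linearly_related_def)
      have "e' = e"
        using generated_in_degree_le[OF _ _ nz] e'(1) generated_in_degree_monomial_ideal[of G e, OF deg]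
        by (meson le_antisym)
      then have "res_deg R 1 b = e + 1" if "b \<in> res_basis R 1" for b
        using e'(2) that unfolding betti by blast
      then show "(g, h) \<in> (linear_step G e L)\<^sup>*"
        using connected_if_linear_relations gh by blast
    qed
  next
    assume "\<forall>L. \<forall>g\<in>G. \<forall>h\<in>G. g adds L \<and> h adds L \<longrightarrow> (g, h) \<in> (linear_step G e L)\<^sup>*"
    then have "res_deg R 1 b = e + 1" if "b \<in> res_basis R 1" for b
      using linear_relations_if_connected that by blast
    then have "\<forall>j. j \<noteq> e + 1 \<longrightarrow> graded_betti 1 j ?J = 0" unfolding betti by blast
    then show "linearly_related ?J"
      unfolding linearly_related_def using generated_in_degree_monomial_ideal[of G e, OF deg] by blast
  qed
qed

section \<open>Unions of disjoint facets\<close>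

text \<open>
  Lists rather than sets of facets are used because the only facet may be the empty set. It is
  disjoint from itself, and all powers of the facet ideal are then the whole ring.
\<close>

definition disjoint_unions :: "'v set set \<Rightarrow> nat \<Rightarrow> 'v set set" where
  "disjoint_unions \<Phi> n = {\<Union>(set xs) | xs. length xs = n \<and> set xs \<subseteq> \<Phi> \<and> sorted_wrt disjnt xs}"

lemma disjoint_unions_0: "disjoint_unions \<Phi> 0 = {{}}"
  by (auto simp: disjoint_unions_def)

lemma disjoint_unions_Suc:
  "disjoint_unions \<Phi> (Suc n) = {F \<union> W | F W. F \<in> \<Phi> \<and> W \<in> disjoint_unions \<Phi> n \<and> F \<inter> W = {}}"
    (is "?L = ?R")
proof (intro equalityI subsetI)
  fix A assume "A \<in> ?L"
  then obtain xs where xs: "length xs = Suc n" "set xs \<subseteq> \<Phi>" "sorted_wrt disjnt xs" "A = \<Union>(set xs)"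
    by (auto simp: disjoint_unions_def)
  then obtain F zs where "xs = F # zs" by (cases xs) auto
  with xs have "F \<in> \<Phi>" "\<Union>(set zs) \<in> disjoint_unions \<Phi> n" "F \<inter> \<Union>(set zs) = {}" "A = F \<union> \<Union>(set zs)"
    by (auto simp: disjoint_unions_def disjnt_def)
  then show "A \<in> ?R" by blast
next
  fix A assume "A \<in> ?R"
  then obtain F xs where "F \<in> \<Phi>" "length xs = n" "set xs \<subseteq> \<Phi>" "sorted_wrt disjnt xs" "F \<inter> \<Union>(set xs) = {}" "A = F \<union> \<Union>(set xs)"
    by (auto simp: disjoint_unions_def)
  then show "A \<in> ?L"
    unfolding disjoint_unions_def by (intro CollectI exI[of _ "F # xs"]) (auto simp: disjnt_def)
qed

lemma disjoint_unions_SucI: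
  "F \<in> \<Phi> \<Longrightarrow> W \<in> disjoint_unions \<Phi> n \<Longrightarrow> F \<inter> W = {} \<Longrightarrow> F \<union> W \<in> disjoint_unions \<Phi> (Suc n)"
  unfolding disjoint_unions_Suc by blast

lemma card_disjoint_unions:
  fixes \<Phi> :: "'v::finite set set"
  assumes "\<And>F. F \<in> \<Phi> \<Longrightarrow> card F = d" "A \<in> disjoint_unions \<Phi> n"
  shows "card A = n * d"
  using assms(2)
proof (induction n arbitrary: A)
  case 0
  then show ?case by (simp add: disjoint_unions_0)
next
  case (Suc n)
  then obtain F W where "A = F \<union> W" "F \<in> \<Phi>" "W \<in> disjoint_unions \<Phi> n" "F \<inter> W = {}"
    unfolding disjoint_unions_Suc by blast
  then show ?case using Suc.IH assms(1) by (simp add: card_Un_disjoint)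
qed

lemma sorted_wrt_disjnt_remove:
  assumes "sorted_wrt disjnt xs" "F \<in> set xs"
  shows "\<exists>zs. length xs = Suc (length zs) \<and> set xs = insert F (set zs) \<and> sorted_wrt disjnt zs \<and>
    (\<forall>H\<in>set zs. F \<inter> H = {})"
proof -
  obtain ys ws where "xs = ys @ F # ws" using split_list[OF assms(2)] by blast
  with assms(1) show ?thesis
    by (intro exI[of _ "ys @ ws"]) (auto simp: sorted_wrt_append disjnt_def)
qed

section \<open>Exchanging a leaf\<close>

text \<open>
  For sets of cardinality \<open>e\<close> this is the squarefree version of \<open>linear_step\<close>, where \<open>W\<close> bounds
  the sets on the path; equal sets are allowed as neighbours.
\<close>

definition set_step :: "'v set set \<Rightarrow> nat \<Rightarrow> 'v set \<Rightarrow> ('v set \<times> 'v set) set" where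
  "set_step \<U> e W = {(A, B). A \<in> \<U> \<and> B \<in> \<U> \<and> A \<subseteq> W \<and> B \<subseteq> W \<and> card (A \<union> B) \<le> e + 1}"

definition linearly_connected :: "'v set set \<Rightarrow> nat \<Rightarrow> bool" where
  "linearly_connected \<U> e \<longleftrightarrow> (\<forall>W. \<forall>A\<in>\<U>. \<forall>B\<in>\<U>. A \<subseteq> W \<and> B \<subseteq> W \<longrightarrow> (A, B) \<in> (set_step \<U> e W)\<^sup>*)"

lemma sym_set_step: "sym (set_step \<U> e W)"
  by (auto simp: set_step_def sym_def Un_commute)

lemma rtrancl_map_subset:
  assumes "\<And>x y. (x, y) \<in> r \<Longrightarrow> (f x, f y) \<in> s\<^sup>*" "(x, y) \<in> r\<^sup>*"
  shows "(f x, f y) \<in> s\<^sup>*"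
  using assms(2) by (induction) (auto intro: rtrancl_trans assms(1))

text \<open>
  Add \<open>F\<close> to every set on a path from \<open>A\<close> to \<open>B\<close>. Such a path exists inside \<open>W - F\<close>, so the unions
  stay disjoint.
\<close>

lemma connected_if_common_facet:
  fixes \<Phi> :: "'v::finite set set"
  assumes conn: "linearly_connected (disjoint_unions \<Phi> n) (n * d)"
    and F: "F \<in> \<Phi>" "card F = d"
    and A: "A \<in> disjoint_unions \<Phi> n" "F \<inter> A = {}" "F \<union> A \<subseteq> W"
    and B: "B \<in> disjoint_unions \<Phi> n" "F \<inter> B = {}" "F \<union> B \<subseteq> W"
  shows "(F \<union> A, F \<union> B) \<in> (set_step (disjoint_unions \<Phi> (Suc n)) (Suc n * d) W)\<^sup>*"
proof (rule rtrancl_map_subset[where f = "(\<union>) F"])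
  show "(A, B) \<in> (set_step (disjoint_unions \<Phi> n) (n * d) (W - F))\<^sup>*"
    using conn[unfolded linearly_connected_def, rule_format, OF A(1) B(1), of "W - F"] A B by blast
next
  fix C D assume CD: "(C, D) \<in> set_step (disjoint_unions \<Phi> n) (n * d) (W - F)"
  have "card (F \<union> C \<union> (F \<union> D)) = card (F \<union> (C \<union> D))" by (rule arg_cong[of _ _ card]) blast
  also have "\<dots> \<le> card F + card (C \<union> D)" by (rule card_Un_le)
  finally have "card (F \<union> C \<union> (F \<union> D)) \<le> Suc n * d + 1"
    using CD F(2) by (simp add: set_step_def)
  moreover have "F \<union> C \<in> disjoint_unions \<Phi> (Suc n)" "F \<union> D \<in> disjoint_unions \<Phi> (Suc n)"
    using CD F(1) by (auto simp: set_step_def intro!: disjoint_unions_SucI)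
  ultimately show "(F \<union> C, F \<union> D) \<in> (set_step (disjoint_unions \<Phi> (Suc n)) (Suc n * d) W)\<^sup>*"
    using CD A(3) by (intro r_into_rtrancl) (auto simp: set_step_def)
qed

text \<open>
  Since the facets in \<open>ys\<close> are disjoint and the intersections with the leaf \<open>F\<close> are all contained in
  that with its joint, \<open>F\<close> meets at most one member \<open>G\<close> of \<open>ys\<close>. Replacing \<open>G\<close> by \<open>F\<close> gives a union
  of disjoint facets again. It has the facet \<open>F\<close> in common with the union of \<open>xs\<close>, and one of the
  remaining \<open>n\<close> facets of \<open>ys\<close> in common with the union of \<open>ys\<close>; so it is connected to both.
\<close>

lemma connected_if_leaf:
  fixes \<Phi> :: "'v::finite set set"
  assumes n: "n \<ge> 1" and card: "\<And>F. F \<in> \<Phi> \<Longrightarrow> card F = d"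
    and conn: "linearly_connected (disjoint_unions \<Phi> n) (n * d)"
    and xs: "length xs = Suc n" "set xs \<subseteq> \<Phi>" "sorted_wrt disjnt xs" "\<Union>(set xs) \<subseteq> W"
    and ys: "length ys = Suc n" "set ys \<subseteq> \<Phi>" "sorted_wrt disjnt ys" "\<Union>(set ys) \<subseteq> W"
    and F: "F \<in> set xs"
    and leaf: "set xs \<union> set ys = {F} \<or>
      (\<exists>G\<in>set xs \<union> set ys. G \<noteq> F \<and> (\<forall>H\<in>set xs \<union> set ys. H \<noteq> F \<longrightarrow> H \<inter> F \<subseteq> G \<inter> F))"
  shows "(\<Union>(set xs), \<Union>(set ys)) \<in> (set_step (disjoint_unions \<Phi> (Suc n)) (Suc n * d) W)\<^sup>*"
proof -
  from sorted_wrt_disjnt_remove[OF xs(3) F] obtain xs' where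
    xs': "length xs = Suc (length xs')" "set xs = insert F (set xs')" "sorted_wrt disjnt xs'"
      "\<forall>H\<in>set xs'. F \<inter> H = {}" by (elim exE conjE)
  \<comment> \<open>Replace \<open>F\<close> itself if it occurs, otherwise the joint if it occurs in \<open>ys\<close>. If the joint belongs to
    \<open>xs\<close>, it is disjoint from \<open>F\<close>; then so are all members of \<open>ys\<close>, and any one can be replaced.\<close>
  obtain G ys' where ys': "length ys = Suc (length ys')" "set ys = insert G (set ys')" "sorted_wrt disjnt ys'"
    "\<forall>H\<in>set ys'. G \<inter> H = {}" "\<forall>H\<in>set ys'. F \<inter> H = {}"
  proof (cases "F \<in> set ys")
    case True
    from sorted_wrt_disjnt_remove[OF ys(3) True] show thesis
      by (elim exE conjE) (rule that)
  next
    case False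
    have "ys \<noteq> []" using ys(1) by auto
    then have hd: "hd ys \<in> set ys" by simp
    then have "set xs \<union> set ys \<noteq> {F}" using False by (metis UnI2 singletonD)
    with leaf have "\<exists>G\<in>set xs \<union> set ys. G \<noteq> F \<and> (\<forall>H\<in>set xs \<union> set ys. H \<noteq> F \<longrightarrow> H \<inter> F \<subseteq> G \<inter> F)"
      by (simp only: simp_thms)
    then obtain G where G: "G \<in> set xs \<union> set ys" "G \<noteq> F"
      and joint: "\<forall>H\<in>set xs \<union> set ys. H \<noteq> F \<longrightarrow> H \<inter> F \<subseteq> G \<inter> F"
      by (elim bexE conjE)
    have joint: "H \<inter> F \<subseteq> G \<inter> F" if "H \<in> set ys" for H
      using joint that False by (metis UnI2)
    show thesis
    proof (cases "G \<in> set ys")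
      case True
      from sorted_wrt_disjnt_remove[OF ys(3) True] obtain zs where
        zs: "length ys = Suc (length zs)" "set ys = insert G (set zs)" "sorted_wrt disjnt zs"
          "\<forall>H\<in>set zs. G \<inter> H = {}" by (elim exE conjE)
      have "F \<inter> H = {}" if "H \<in> set zs" for H
        using zs(4) joint[of H] that zs(2) by blast
      then show thesis by (intro that[OF zs]) simp
    next
      case notin: False
      then have "G \<inter> F = {}" using G(1,2) xs'(2,4) by blast
      from sorted_wrt_disjnt_remove[OF ys(3) hd] obtain zs where
        zs: "length ys = Suc (length zs)" "set ys = insert (hd ys) (set zs)" "sorted_wrt disjnt zs"
          "\<forall>H\<in>set zs. hd ys \<inter> H = {}" by (elim exE conjE)
      have "F \<inter> H = {}" if "H \<in> set zs" for H
        using \<open>G \<inter> F = {}\<close> joint[of H] that zs(2) by blast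
      then show thesis by (intro that[OF zs]) simp
    qed
  qed
  define A0 where "A0 = \<Union>(set xs')"
  define B0 where "B0 = \<Union>(set ys')"
  have A: "\<Union>(set xs) = F \<union> A0" "A0 \<in> disjoint_unions \<Phi> n" "F \<inter> A0 = {}" "F \<in> \<Phi>"
    using xs xs' by (auto simp: A0_def disjoint_unions_def)
  have B: "\<Union>(set ys) = G \<union> B0" "B0 \<in> disjoint_unions \<Phi> n" "G \<inter> B0 = {}" "F \<inter> B0 = {}" "G \<in> \<Phi>"
    using ys ys' by (auto simp: B0_def disjoint_unions_def)
  have W: "F \<union> A0 \<subseteq> W" "G \<union> B0 \<subseteq> W" using xs(4) ys(4) A(1) B(1) by auto
  obtain m where m: "n = Suc m" using n by (cases n) auto
  obtain H B1 where B1: "B0 = H \<union> B1" "H \<in> \<Phi>" "B1 \<in> disjoint_unions \<Phi> m" "H \<inter> B1 = {}"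
    using B(2) unfolding m disjoint_unions_Suc by blast
  have "(F \<union> A0, F \<union> B0) \<in> (set_step (disjoint_unions \<Phi> (Suc n)) (Suc n * d) W)\<^sup>*"
    by (rule connected_if_common_facet[OF conn A(4) card[OF A(4)]]) (use A B W in auto)
  moreover have "(H \<union> (F \<union> B1), H \<union> (G \<union> B1)) \<in> (set_step (disjoint_unions \<Phi> (Suc n)) (Suc n * d) W)\<^sup>*"
  proof (rule connected_if_common_facet[OF conn B1(2) card[OF B1(2)]])
    show "F \<union> B1 \<in> disjoint_unions \<Phi> n" "G \<union> B1 \<in> disjoint_unions \<Phi> n"
      using A B B1 unfolding m by (auto intro!: disjoint_unions_SucI)
  qed (use A B B1 W in auto)
  moreover have "H \<union> (F \<union> B1) = F \<union> B0" "H \<union> (G \<union> B1) = G \<union> B0" using B1(1) by auto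
  ultimately show ?thesis unfolding A(1) B(1) by (metis rtrancl_trans)
qed

lemma facets_generated_complex:
  assumes "\<And>F G. F \<in> \<Psi> \<Longrightarrow> G \<in> \<Psi> \<Longrightarrow> F \<subseteq> G \<Longrightarrow> F = G"
  shows "facets {G. \<exists>F\<in>\<Psi>. G \<subseteq> F} = \<Psi>"
proof (intro equalityI subsetI)
  fix F assume "F \<in> facets {G. \<exists>F\<in>\<Psi>. G \<subseteq> F}"
  then obtain H where "H \<in> \<Psi>" "F \<subseteq> H" "\<forall>G. (\<exists>F\<in>\<Psi>. G \<subseteq> F) \<longrightarrow> F \<subseteq> G \<longrightarrow> G = F"
    by (auto simp: facets_def)
  then show "F \<in> \<Psi>" by blast
next
  fix F assume F: "F \<in> \<Psi>"
  have "G = F" if "H \<in> \<Psi>" "G \<subseteq> H" "F \<subseteq> G" for G H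
    using assms[OF F that(1)] that by blast
  with F show "F \<in> facets {G. \<exists>F\<in>\<Psi>. G \<subseteq> F}"
    unfolding facets_def by blast
qed

text \<open>
  The facets occurring in the two given unions span a nonempty subcollection, whose leaf belongs to
  one of the two; the relation to be shown is symmetric.
\<close>

lemma linearly_connected_Suc:
  fixes \<Delta> :: "'v::finite set set"
  assumes tree: "simplicial_tree \<Delta>" and card: "\<And>F. F \<in> facets \<Delta> \<Longrightarrow> card F = d" and n: "n \<ge> 1"
    and conn: "linearly_connected (disjoint_unions (facets \<Delta>) n) (n * d)"
  shows "linearly_connected (disjoint_unions (facets \<Delta>) (Suc n)) (Suc n * d)"
  unfolding linearly_connected_def
proof (intro allI ballI impI, elim conjE)
  let ?\<Phi> = "facets \<Delta>"
  fix W A B assume "A \<in> disjoint_unions ?\<Phi> (Suc n)" "B \<in> disjoint_unions ?\<Phi> (Suc n)" and W: "A \<subseteq> W" "B \<subseteq> W"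
  then obtain xs ys where xs: "length xs = Suc n" "set xs \<subseteq> ?\<Phi>" "sorted_wrt disjnt xs" "A = \<Union>(set xs)"
    and ys: "length ys = Suc n" "set ys \<subseteq> ?\<Phi>" "sorted_wrt disjnt ys" "B = \<Union>(set ys)"
    by (auto simp: disjoint_unions_def)
  let ?\<Psi> = "set xs \<union> set ys"
  let ?D = "{G. \<exists>F\<in>?\<Psi>. G \<subseteq> F}"
  have facets_D: "facets ?D = ?\<Psi>"
  proof (rule facets_generated_complex)
    fix F G assume "F \<in> ?\<Psi>" "G \<in> ?\<Psi>" "F \<subseteq> G"
    moreover from this xs(2) ys(2) have "F \<in> facets \<Delta>" "G \<in> facets \<Delta>" by blast+
    ultimately show "F = G" unfolding facets_def by simp
  qed
  have ne: "?\<Psi> \<noteq> {}" using xs(1) by auto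
  then obtain H where "H \<in> ?\<Psi>" by (metis ex_in_conv)
  then have "{} \<in> ?D" by (intro CollectI bexI[of _ H]) simp_all
  then have "simplicial_complex ?D" unfolding simplicial_complex_def by blast
  then have "subcollection ?D \<Delta>"
    using xs(2) ys(2) by (simp add: subcollection_def facets_D)
  moreover have "\<forall>D'. subcollection D' \<Delta> \<and> facets D' \<noteq> {} \<longrightarrow> (\<exists>F. leaf D' F)"
    using tree unfolding simplicial_tree_def by (elim conjE)
  moreover have "facets ?D \<noteq> {}" using ne by (simp only: facets_D not_False_eq_True)
  ultimately obtain F where F: "leaf ?D F" by metis
  then have leaf: "F \<in> ?\<Psi>" "?\<Psi> = {F} \<or> (\<exists>G\<in>?\<Psi>. G \<noteq> F \<and> (\<forall>H\<in>?\<Psi>. H \<noteq> F \<longrightarrow> H \<inter> F \<subseteq> G \<inter> F))"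
    unfolding leaf_def facets_D by simp_all
  show "(A, B) \<in> (set_step (disjoint_unions ?\<Phi> (Suc n)) (Suc n * d) W)\<^sup>*"
  proof (cases "F \<in> set xs")
    case True
    show ?thesis unfolding xs(4) ys(4)
      by (rule connected_if_leaf[OF n card conn _ _ _ _ _ _ _ _ True leaf(2)]) (use xs ys W in auto)
  next
    case False
    then have F: "F \<in> set ys" using leaf(1) by blast
    have "(B, A) \<in> (set_step (disjoint_unions ?\<Phi> (Suc n)) (Suc n * d) W)\<^sup>*" unfolding xs(4) ys(4)
      by (rule connected_if_leaf[OF n card conn _ _ _ _ _ _ _ _ F leaf(2)[unfolded Un_commute[of "set xs"]]])
         (use xs ys W in auto)
    then show ?thesis by (rule symD[OF sym_rtrancl[OF sym_set_step]])
  qed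
qed

section \<open>Squarefree powers of facet ideals\<close>

definition set_expo :: "'v::finite set \<Rightarrow> 'v expo" where
  "set_expo A = (\<Sum>v\<in>A. single v 1)"

lemma lookup_set_expo: "lookup (set_expo A) v = (if v \<in> A then 1 else 0)"
  by (simp add: set_expo_def lookup_sum lookup_single when_def)

lemma keys_set_expo [simp]: "keys (set_expo A) = A"
  by (auto simp: in_keys_iff lookup_set_expo split: if_splits)

lemma expo_deg_set_expo [simp]: "expo_deg (set_expo A) = card A"
  by (simp add: expo_deg_def lookup_set_expo flip: sum.inter_filter)

lemma set_expo_Un: "A \<inter> B = {} \<Longrightarrow> set_expo (A \<union> B) = set_expo A + set_expo B"
  by (auto intro!: poly_mapping_eqI simp: lookup_set_expo lookup_add)

lemma monom_add: "monom (a + b) = monom a * monom b"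
  by (simp add: monom_def mult_single)

lemma monom_set_expo: "monom (set_expo F) = (\<Prod>v\<in>F. var v)"
proof (induction F rule: infinite_finite_induct)
  case (insert v F)
  then have "set_expo (insert v F) = single v 1 + set_expo F" by (simp add: set_expo_def)
  then show ?case using insert by (simp add: var_def monom_add)
qed (simp_all add: set_expo_def monom_def)

lemma adds_iff: "a adds b \<longleftrightarrow> (\<forall>v. lookup a v \<le> lookup b v)"
proof
  assume "\<forall>v. lookup a v \<le> lookup b v"
  then have "b = a + (b - a)" by (intro poly_mapping_eqI) (simp add: lookup_add lookup_minus)
  then show "a adds b" unfolding adds_def by blast
qed (auto simp: adds_def lookup_add)

text \<open>
  From sets to exponents, a path inside \<open>A \<union> B\<close> remains below every common multiple of the two
  squarefree monomials. Conversely, only the squarefree bounds \<open>L\<close> are used, and the supports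
  of the exponents on a path form a path of sets.
\<close>

lemma linearly_connected_iff:
  fixes \<U> :: "'v::finite set set"
  assumes card: "\<And>A. A \<in> \<U> \<Longrightarrow> card A = e"
  shows "linearly_connected \<U> e \<longleftrightarrow>
    (\<forall>L. \<forall>g\<in>set_expo ` \<U>. \<forall>h\<in>set_expo ` \<U>. g adds L \<and> h adds L \<longrightarrow> (g, h) \<in> (linear_step (set_expo ` \<U>) e L)\<^sup>*)"
proof
  assume conn: "linearly_connected \<U> e"
  show "\<forall>L. \<forall>g\<in>set_expo ` \<U>. \<forall>h\<in>set_expo ` \<U>. g adds L \<and> h adds L \<longrightarrow> (g, h) \<in> (linear_step (set_expo ` \<U>) e L)\<^sup>*"
  proof (intro allI ballI impI, elim conjE imageE)
    fix L g h A B assume AB: "g = set_expo A" "h = set_expo B" "A \<in> \<U>" "B \<in> \<U>" and adds: "g adds L" "h adds L"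
    have "(set_expo A, set_expo B) \<in> (linear_step (set_expo ` \<U>) e L)\<^sup>*"
    proof (rule rtrancl_map_subset[where f = set_expo])
      show "(A, B) \<in> (set_step \<U> e (A \<union> B))\<^sup>*"
        using conn[unfolded linearly_connected_def, rule_format, OF AB(3,4), of "A \<union> B"] by blast
    next
      fix C D assume CD: "(C, D) \<in> set_step \<U> e (A \<union> B)"
      show "(set_expo C, set_expo D) \<in> (linear_step (set_expo ` \<U>) e L)\<^sup>*"
      proof (cases "C = D")
        case False
        have "card C = e" "card D = e" using CD card by (auto simp: set_step_def)
        then have "card (C \<union> D) \<noteq> e"
          using False by (metis card_subset_eq finite sup_ge1 sup_ge2)
        moreover have "card C \<le> card (C \<union> D)" by (intro card_mono) auto
        ultimately have "card (C \<union> D) = e + 1"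
          using CD \<open>card C = e\<close> by (auto simp: set_step_def)
        moreover have "set_expo C adds set_expo (C \<union> D)" "set_expo D adds set_expo (C \<union> D)"
          by (auto simp: adds_iff lookup_set_expo)
        moreover have "set_expo (C \<union> D) adds L"
          unfolding adds_iff
        proof
          fix v
          have "lookup (set_expo A) v \<le> lookup L v" "lookup (set_expo B) v \<le> lookup L v"
            using adds unfolding AB adds_iff by blast+
          moreover have "C \<union> D \<subseteq> A \<union> B" using CD by (auto simp: set_step_def)
          ultimately show "lookup (set_expo (C \<union> D)) v \<le> lookup L v"
            by (auto simp: lookup_set_expo split: if_splits)
        qed
        ultimately have "(set_expo C, set_expo D) \<in> linear_step (set_expo ` \<U>) e L"
          unfolding linear_step_def using CD
          by (auto simp: set_step_def intro!: exI[of _ "set_expo (C \<union> D)"])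
        then show ?thesis by blast
      qed simp
    qed
    then show "(g, h) \<in> (linear_step (set_expo ` \<U>) e L)\<^sup>*" by (simp add: AB)
  qed
next
  assume conn: "\<forall>L. \<forall>g\<in>set_expo ` \<U>. \<forall>h\<in>set_expo ` \<U>. g adds L \<and> h adds L \<longrightarrow> (g, h) \<in> (linear_step (set_expo ` \<U>) e L)\<^sup>*"
  show "linearly_connected \<U> e"
    unfolding linearly_connected_def
  proof (intro allI ballI impI, elim conjE)
    fix W A B assume AB: "A \<in> \<U>" "B \<in> \<U>" "A \<subseteq> W" "B \<subseteq> W"
    have sub: "C \<subseteq> W" if "set_expo C adds m" "m adds set_expo W" for C m
      using adds_trans[OF that] by (force simp: adds_iff lookup_set_expo split: if_splits)
    have "(keys (set_expo A), keys (set_expo B)) \<in> (set_step \<U> e W)\<^sup>*"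
    proof (rule rtrancl_map_subset[where f = keys])
      have "set_expo A adds set_expo W" "set_expo B adds set_expo W"
        using AB by (auto simp: adds_iff lookup_set_expo)
      then show "(set_expo A, set_expo B) \<in> (linear_step (set_expo ` \<U>) e (set_expo W))\<^sup>*"
        using conn AB by blast
    next
      fix g h assume "(g, h) \<in> linear_step (set_expo ` \<U>) e (set_expo W)"
      then obtain C D m where CD: "C \<in> \<U>" "D \<in> \<U>" "g = set_expo C" "h = set_expo D"
        and m: "expo_deg m = e + 1" "g adds m" "h adds m" "m adds set_expo W"
        by (auto simp: linear_step_def)
      have "set_expo (C \<union> D) adds m"
        using m(2,3) unfolding CD adds_iff lookup_set_expo by (metis Un_iff)
      then have "card (C \<union> D) \<le> e + 1" using adds_deg_le m(1) by fastforce
      then show "(keys g, keys h) \<in> (set_step \<U> e W)\<^sup>*"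
        using CD m sub by (auto simp: set_step_def)
    qed
    then show "(A, B) \<in> (set_step \<U> e W)\<^sup>*" by simp
  qed
qed

primrec sums_of_facets :: "'v::finite set set \<Rightarrow> nat \<Rightarrow> 'v expo set" where
  "sums_of_facets \<Phi> 0 = {0}"
| "sums_of_facets \<Phi> (Suc n) = {set_expo F + p | F p. F \<in> \<Phi> \<and> p \<in> sums_of_facets \<Phi> n}"

lemma facet_ideal_eq: "facet_ideal \<Delta> = ideal_gen (monom ` set_expo ` facets \<Delta>)"
  by (simp add: facet_ideal_def monom_set_expo image_image)

lemma ideal_power_facet_ideal:
  "ideal_power (facet_ideal \<Delta> :: ('v::finite, 'k::field) mpoly set) n = ideal_gen (monom ` sums_of_facets (facets \<Delta>) n)"
proof (induction n)
  case 0
  have "(p :: ('v, 'k) mpoly) \<in> ideal_gen (monom ` {0})" for p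
    unfolding mem_monomial_ideal_iff by (auto simp: adds_def)
  then show ?case by (simp add: UNIV_eq_I)
next
  case (Suc n)
  let ?I = "facet_ideal \<Delta> :: ('v, 'k) mpoly set"
  let ?K = "ideal_gen (monom ` sums_of_facets (facets \<Delta>) n) :: ('v, 'k) mpoly set"
  let ?S = "sums_of_facets (facets \<Delta>) (Suc n)"
  have "ideal_gen {p * q | p q. p \<in> ?I \<and> q \<in> ?K} = ideal_gen (monom ` ?S)"
  proof
    have "p * q \<in> ideal_gen (monom ` ?S)" if pq: "p \<in> ?I" "q \<in> ?K" for p q
      unfolding mem_monomial_ideal_iff
    proof
      fix a assume "a \<in> keys (p * q)"
      then obtain b c where bc: "a = b + c" "b \<in> keys p" "c \<in> keys q" using keys_mult[of p q] by blast
      obtain F where F: "F \<in> facets \<Delta>" "set_expo F adds b"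
        using pq(1) bc(2) unfolding facet_ideal_eq mem_monomial_ideal_iff by blast
      obtain s where s: "s \<in> sums_of_facets (facets \<Delta>) n" "s adds c"
        using pq(2) bc(3) unfolding mem_monomial_ideal_iff by blast
      have "set_expo F + s adds a"
        using F(2) s(2) unfolding bc adds_iff by (simp add: lookup_add add_mono)
      moreover have "set_expo F + s \<in> ?S" using F s by auto
      ultimately show "\<exists>g\<in>?S. g adds a" by blast
    qed
    then show "ideal_gen {p * q | p q. p \<in> ?I \<and> q \<in> ?K} \<subseteq> ideal_gen (monom ` ?S)"
      unfolding ideal_gen_def[of "{p * q | p q. p \<in> ?I \<and> q \<in> ?K}"]
      by (intro ideal.span_minimal) (auto simp: ideal_gen_def)
  next
    have "monom ` ?S \<subseteq> {p * q | p q. p \<in> ?I \<and> q \<in> ?K}"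
    proof (rule image_subsetI)
      fix s assume "s \<in> ?S"
      then obtain F t where Ft: "s = set_expo F + t" "F \<in> facets \<Delta>" "t \<in> sums_of_facets (facets \<Delta>) n" by auto
      have "(monom s :: ('v, 'k) mpoly) = monom (set_expo F) * monom t" by (simp add: Ft(1) monom_def mult_single)
      moreover have "monom (set_expo F) \<in> ?I" "(monom t :: ('v, 'k) mpoly) \<in> ?K"
        unfolding facet_ideal_eq using Ft by (auto intro: monom_mem_monomial_ideal)
      ultimately show "monom s \<in> {p * q | p q. p \<in> ?I \<and> q \<in> ?K}" by blast
    qed
    then show "ideal_gen (monom ` ?S) \<subseteq> ideal_gen {p * q | p q. p \<in> ?I \<and> q \<in> ?K}"
      unfolding ideal_gen_def by (rule ideal.span_mono)
  qed
  then show ?case by (simp only: ideal_power.simps Suc.IH)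
qed

lemma inj_monom: "inj (monom :: 'v expo \<Rightarrow> ('v, 'k::field) mpoly)"
  by (rule injI) (metis keys_single monom_def singleton_inject zero_neq_one)

lemma monom_mem_iff: "(monom a :: ('v, 'k::field) mpoly) \<in> ideal_gen (monom ` G) \<longleftrightarrow> (\<exists>g\<in>G. g adds a)"
  unfolding mem_monomial_ideal_iff by (simp add: monom_def)

lemma monom_dvd_iff: "(monom a :: ('v, 'k::field) mpoly) dvd monom b \<longleftrightarrow> a adds b"
proof
  assume "(monom a :: ('v, 'k) mpoly) dvd monom b"
  then obtain r :: "('v, 'k) mpoly" where "monom b = monom a * r" by blast
  then have "b \<in> keys (single a 1 * r)" by (metis keys_single monom_def singletonI zero_neq_one)
  then show "a adds b" using keys_monom_mult[of a 1 r] by (auto simp: adds_def)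
next
  assume "a adds b"
  then obtain c where "b = a + c" by (auto simp: adds_def)
  then have "(monom b :: ('v, 'k) mpoly) = monom a * monom c" by (simp add: monom_def mult_single)
  then show "(monom a :: ('v, 'k) mpoly) dvd monom b" by simp
qed

text \<open>
  A monomial in the ideal is divisible by a generator, and a divisor of a generator within the ideal
  has at least, hence exactly, the degree of the generator.
\<close>

lemma min_monomial_gens_equigenerated:
  fixes G :: "'v::finite expo set"
  assumes deg: "\<And>g. g \<in> G \<Longrightarrow> expo_deg g = e"
  shows "min_monomial_gens (ideal_gen (monom ` G) :: ('v, 'k::field) mpoly set) = monom ` G"
proof (intro equalityI subsetI)
  fix u assume u: "u \<in> min_monomial_gens (ideal_gen (monom ` G) :: ('v, 'k) mpoly set)"
  then obtain a where a: "u = monom a" "monom a \<in> (ideal_gen (monom ` G) :: ('v, 'k) mpoly set)"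
    by (auto simp: min_monomial_gens_def)
  then obtain g where g: "g \<in> G" "g adds a" unfolding monom_mem_iff by blast
  then have "(monom g :: ('v, 'k) mpoly) dvd u" unfolding a(1) monom_dvd_iff by simp
  then have "monom g = u"
    using u monom_mem_monomial_ideal[OF g(1)]
    by (auto simp: min_monomial_gens_def dest!: bspec[of _ _ "monom g"])
  then show "u \<in> monom ` G" using g(1) by blast
next
  fix u assume "u \<in> (monom ` G :: ('v, 'k) mpoly set)"
  then obtain g where g: "g \<in> G" "u = monom g" by blast
  have "w = u" if w: "w \<in> range monom \<inter> ideal_gen (monom ` G)" "w dvd u" for w :: "('v, 'k) mpoly"
  proof -
    obtain a where a: "w = monom a" using w by blast
    from w have "(monom a :: ('v, 'k) mpoly) \<in> ideal_gen (monom ` G)" by (simp add: a)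
    then obtain h where h: "h \<in> G" "h adds a" unfolding monom_mem_iff by blast
    have "a adds g" using w(2) unfolding a g(2) monom_dvd_iff .
    moreover have "expo_deg g \<le> expo_deg a" using deg[OF g(1)] deg[OF h(1)] adds_deg_le[OF h(2)] by simp
    ultimately show ?thesis using adds_same_deg a g(2) by blast
  qed
  then show "u \<in> min_monomial_gens (ideal_gen (monom ` G))"
    unfolding min_monomial_gens_def using monom_mem_monomial_ideal[OF g(1)] by (simp add: g(2))
qed

text \<open>
  A product of facet monomials is squarefree exactly if no vertex is covered twice.
\<close>

lemma squarefree_sums_of_facets:
  "{a \<in> sums_of_facets \<Phi> n. \<forall>v. lookup a v \<le> 1} = set_expo ` disjoint_unions \<Phi> n"
proof (induction n)
  case 0
  then show ?case by (auto simp: disjoint_unions_0 set_expo_def)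
next
  case (Suc n)
  show ?case
  proof (intro equalityI subsetI)
    fix a assume "a \<in> {a \<in> sums_of_facets \<Phi> (Suc n). \<forall>v. lookup a v \<le> 1}"
    then obtain F p where a: "a = set_expo F + p" "F \<in> \<Phi>" "p \<in> sums_of_facets \<Phi> n"
      and sq: "\<And>v. lookup (set_expo F) v + lookup p v \<le> 1" by (auto simp: lookup_add)
    have "lookup p v \<le> 1" for v using sq[of v] by simp
    then obtain W where W: "W \<in> disjoint_unions \<Phi> n" "p = set_expo W"
      using Suc.IH a(3) by blast
    have "F \<inter> W = {}"
    proof (rule ccontr)
      assume "F \<inter> W \<noteq> {}"
      then obtain v where "v \<in> F" "v \<in> W" by blast
      then show False using sq[of v] by (simp add: W lookup_set_expo)
    qed
    then show "a \<in> set_expo ` disjoint_unions \<Phi> (Suc n)"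
      using disjoint_unions_SucI[OF a(2) W(1)] by (auto simp: a(1) W(2) simp flip: set_expo_Un)
  next
    fix a assume "a \<in> set_expo ` disjoint_unions \<Phi> (Suc n)"
    then obtain F W where FW: "F \<in> \<Phi>" "W \<in> disjoint_unions \<Phi> n" "F \<inter> W = {}" "a = set_expo (F \<union> W)"
      unfolding disjoint_unions_Suc by blast
    have "set_expo W \<in> sums_of_facets \<Phi> n" using FW(2) Suc.IH by blast
    then show "a \<in> {a \<in> sums_of_facets \<Phi> (Suc n). \<forall>v. lookup a v \<le> 1}"
      using FW(1) set_expo_Un[OF FW(3)] lookup_set_expo[of "F \<union> W"] by (auto simp: FW(4))
  qed
qed

lemma expo_deg_sums_of_facets:
  assumes "\<And>F. F \<in> \<Phi> \<Longrightarrow> card F = d" "a \<in> sums_of_facets \<Phi> n"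
  shows "expo_deg a = n * d"
  using assms(2) by (induction n arbitrary: a) (auto simp: expo_deg_add assms(1))

lemma squarefree_power_facet_ideal:
  fixes \<Delta> :: "'v::finite set set"
  assumes "\<And>F. F \<in> facets \<Delta> \<Longrightarrow> card F = d"
  shows "squarefree_power (facet_ideal \<Delta> :: ('v, 'k::field) mpoly set) n =
    ideal_gen (monom ` set_expo ` disjoint_unions (facets \<Delta>) n)"
proof -
  have "min_monomial_gens (ideal_power (facet_ideal \<Delta> :: ('v, 'k) mpoly set) n) \<inter> squarefree_monomials
      = monom ` (sums_of_facets (facets \<Delta>) n \<inter> {a. \<forall>v. lookup a v \<le> 1})"
    unfolding ideal_power_facet_ideal squarefree_monomials_def
    by (subst min_monomial_gens_equigenerated[OF expo_deg_sums_of_facets[OF assms]])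
       (simp_all add: image_Int[OF inj_monom])
  also have "\<dots> = monom ` set_expo ` disjoint_unions (facets \<Delta>) n"
    unfolding squarefree_sums_of_facets[symmetric] by (simp only: Int_def mem_Collect_eq)
  finally show ?thesis by (simp add: squarefree_power_def)
qed

section \<open>Linearly related squarefree powers\<close>

theorem theorem3p6:
  fixes \<Delta> :: "'v::finite set set" and k :: nat
  assumes "simplicial_tree \<Delta>"
    and "pure_complex \<Delta>"
    and "k \<ge> 1"
    and "linearly_related (squarefree_power (facet_ideal \<Delta> :: ('v, 'k::field) mpoly set) k)"
  shows "linearly_related (squarefree_power (facet_ideal \<Delta> :: ('v, 'k) mpoly set) (k + 1))"
proof -
  obtain d where d: "\<And>F. F \<in> facets \<Delta> \<Longrightarrow> card F = d"
    using assms(2) unfolding pure_complex_def by metis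
  have iff: "linearly_related (squarefree_power (facet_ideal \<Delta> :: ('v, 'k) mpoly set) n) \<longleftrightarrow>
      linearly_connected (disjoint_unions (facets \<Delta>) n) (n * d)" for n
  proof -
    have card: "\<And>A. A \<in> disjoint_unions (facets \<Delta>) n \<Longrightarrow> card A = n * d"
      by (rule card_disjoint_unions[OF d])
    then have deg: "\<And>g. g \<in> set_expo ` disjoint_unions (facets \<Delta>) n \<Longrightarrow> expo_deg g = n * d"
      by auto
    have "squarefree_power (facet_ideal \<Delta> :: ('v, 'k) mpoly set) n =
        ideal_gen (monom ` set_expo ` disjoint_unions (facets \<Delta>) n)"
      by (rule squarefree_power_facet_ideal[OF d])
    then show ?thesis
      by (simp only: linearly_related_monomial_ideal_iff[OF deg] linearly_connected_iff[OF card])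
  qed
  show ?thesis
    using linearly_connected_Suc[OF assms(1) d assms(3)] assms(4) unfolding iff by simp
qed

end
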